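(* Let $A_1,\alpha_1,f_0\in\mathbb{R}$, $\sigma_1>0$, $\lambda>0$, $B>0$, $\beta<0$, $\gamma\ge 0$, and let $\bar f(t,r;h)$, $\bar v(t,r;h)$ be the conditional expectation and conditional variance of the logarithm of capital given the interest rate, as defined in the context (Vasicek interest rate, uniform initial distribution on $[-L,L]$ with $L\to\infty$). Then for all $t>0$, $r\in\mathbb{R}$ and $h\in\mathbb{R}$, $$\bar f(t,r;h)=M_2h^2+M_1h+M_0,\qquad \bar v(t,r;h)=L_2h^2+L_1h+L_0,$$ where $$M_2=-\frac{\sigma_1^2t}{2},\qquad M_1=\frac{(\alpha_1-1)(\beta r+B)(1-e^{-\beta t})}{\beta^2}-\frac{(B(\alpha_1-1)-\beta A_1)t}{\beta},$$ $$M_0=\frac{(\beta r+B)(1-e^{-\beta t})}{\beta^2}-\frac{Bt}{\beta}+f_0,$$ $$L_2=-\frac{\lambda^2}{2\beta^3}(\alpha_1-1)^2\phi(t)+\sigma_1^2t,\qquad L_1=-\frac{\lambda^2}{\beta^3}(\alpha_1-1)\phi(t),\qquad L_0=-\frac{\lambda^2}{2\beta^3}\phi(t),$$ $$\phi(t)=e^{-2\beta t}-4e^{-\beta t}-2\beta t+3.$$ Moreover, for all $t>0$ and $r\in\mathbb{R}$ the function $h\mapsto \bar Q_\gamma(t,r;h):=\bar f(t,r;h)-\gamma\,\bar v(t,r;h)$ on $\mathbb{R}$ has a unique point of maximum, namely $$\bar H_\gamma=\frac{M_1-\gamma L_1}{\sigma_1^2t+2\gamma L_2}.$$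
   Context: Market: a risky asset $S_1$ and a bank account $S_2$ with $$\frac{dS_1(t)}{S_1(t)}=(A_1+\alpha_1R(t))\,dt+\sigma_1\,dW_1(t),\qquad \frac{dS_2(t)}{S_2(t)}=R(t)\,dt,$$ and interest rate (Vasicek model) $dR(t)=(B+\beta R(t))\,dt+\lambda\,dW_2(t)$, where $W_1,W_2$ are independent standard Brownian motions. A constant proportion $h\in\mathbb{R}$ of capital is held in $S_1$ and $1-h$ in $S_2$. The logarithm of capital $F=\ln V$ then satisfies $$dF(t)=\Big[hA_1-\tfrac{h^2\sigma_1^2}{2}+(h\alpha_1+1-h)R(t)\Big]dt+h\sigma_1\,dW_1(t).$$ Conditional moments: for $L>0$ let $F(0)=f_0$ and let $R(0)$ be uniformly distributed on $[-L,L]$, independent of $(W_1,W_2)$. Let $P_L(t,f,r)$ be the joint probability density of $(F(t),R(t))$ for $t>0$ (the solution of the corresponding Fokker–Planck equation with initial data $\delta(f-f_0)\frac{1}{2L}\chi_{[-L,L]}(r)$). Define $$\bar f(t,r;h)=\lim_{L\to+\infty}\frac{\int_{[-L,L]}f\,P_L(t,f,r)\,df}{\int_{[-L,L]}P_L(t,f,r)\,df},$$ $$\bar v(t,r;h)=\lim_{L\to+\infty}\frac{\int_{[-L,L]}f^2P_L(t,f,r)\,df}{\int_{[-L,L]}P_L(t,f,r)\,df}-\bar f(t,r;h)^2 .$$ *)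

theory Defs
  imports "HOL-Probability.Probability"
begin

definition (in prob_space) brownian_motion :: "(real \<Rightarrow> 'a \<Rightarrow> real) \<Rightarrow> bool" where
  "brownian_motion W \<longleftrightarrow>
     (\<forall>t\<ge>0. random_variable borel (W t)) \<and>
     (AE \<omega> in M. W 0 \<omega> = 0) \<and>
     (AE \<omega> in M. continuous_on {0..} (\<lambda>t. W t \<omega>)) \<and>
     (\<forall>s t. 0 \<le> s \<longrightarrow> s < t \<longrightarrow>
        distributed M lborel (\<lambda>\<omega>. W t \<omega> - W s \<omega>)
          (\<lambda>x. ennreal (normal_density 0 (sqrt (t - s)) x))) \<and>
     (\<forall>(n::nat) \<tau>. 0 \<le> \<tau> 0 \<longrightarrow> (\<forall>i<n. \<tau> i \<le> \<tau> (Suc i)) \<longrightarrow>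
        indep_vars (\<lambda>_. borel) (\<lambda>i \<omega>. W (\<tau> (Suc i)) \<omega> - W (\<tau> i) \<omega>) {..<n})"

definition path_space :: "(real \<Rightarrow> real) measure" where
  "path_space = PiM {0..} (\<lambda>_. borel)"

definition path :: "(real \<Rightarrow> 'a \<Rightarrow> real) \<Rightarrow> 'a \<Rightarrow> real \<Rightarrow> real" where
  "path W \<omega> = restrict (\<lambda>t. W t \<omega>) {0..}"

text \<open>
  \<open>R L t\<close> is the interest rate started from the uniform distribution on \<open>[-L, L]\<close>, and
  \<open>F h L t\<close> is the corresponding logarithm of capital when the proportion \<open>h\<close> is held in the
  risky asset; \<open>\<nu>\<close> is the volatility of the interest rate.  Both noise coefficients are
  constants, so the stochastic integrals are multiples of the Brownian motions and the
  stochastic differential equations are pathwise integral equations.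
\<close>

locale vasicek_log_capital = prob_space M for M :: "'a measure" +
  fixes W1 W2 :: "real \<Rightarrow> 'a \<Rightarrow> real"
    and A1 \<alpha>1 \<sigma>1 B \<beta> \<nu> f0 :: real
    and R :: "real \<Rightarrow> real \<Rightarrow> 'a \<Rightarrow> real"
    and F :: "real \<Rightarrow> real \<Rightarrow> real \<Rightarrow> 'a \<Rightarrow> real"
  assumes W1: "brownian_motion W1"
    and W2: "brownian_motion W2"
    and indep_W1_W2: "indep_var path_space (path W1) path_space (path W2)"
    and R_measurable: "0 < L \<Longrightarrow> 0 \<le> t \<Longrightarrow> random_variable borel (R L t)"
    and R_initial: "0 < L \<Longrightarrow> distr M borel (R L 0) = uniform_measure lborel {-L..L}"
    and R_initial_indep: "0 < L \<Longrightarrow>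
      indep_set (sets (vimage_algebra (space M) (R L 0) borel))
        (sets (vimage_algebra (space M) (\<lambda>\<omega>. (path W1 \<omega>, path W2 \<omega>))
          (path_space \<Otimes>\<^sub>M path_space)))"
    and R_continuous: "0 < L \<Longrightarrow> AE \<omega> in M. continuous_on {0..} (\<lambda>t. R L t \<omega>)"
    and R_sde: "0 < L \<Longrightarrow> AE \<omega> in M. \<forall>t\<ge>0.
      R L t \<omega> = R L 0 \<omega> + integral {0..t} (\<lambda>s. B + \<beta> * R L s \<omega>) + \<nu> * W2 t \<omega>"
    and F_measurable: "0 < L \<Longrightarrow> 0 \<le> t \<Longrightarrow> random_variable borel (F h L t)"
    and F_sde: "0 < L \<Longrightarrow> AE \<omega> in M. \<forall>t\<ge>0.
      F h L t \<omega> = f0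
        + integral {0..t} (\<lambda>s. h * A1 - h\<^sup>2 * \<sigma>1\<^sup>2 / 2 + (h * \<alpha>1 + 1 - h) * R L s \<omega>)
        + h * \<sigma>1 * W1 t \<omega>"

text \<open>
  Conditioning on the null event \<open>R(t) = r\<close> needs pointwise values of the density, hence
  the continuous version, which is unique if it exists.
\<close>

definition joint_density ::
    "'a measure \<Rightarrow> ('a \<Rightarrow> real) \<Rightarrow> ('a \<Rightarrow> real) \<Rightarrow> real \<Rightarrow> real \<Rightarrow> real" where
  "joint_density M X Y = (THE p.
     continuous_on UNIV (\<lambda>(x, y). p x y) \<and> (\<forall>x y. 0 \<le> p x y) \<and>
     distributed M (lborel \<Otimes>\<^sub>M lborel) (\<lambda>\<omega>. (X \<omega>, Y \<omega>)) (\<lambda>(x, y). ennreal (p x y)))"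

definition truncated_cond_moment ::
    "nat \<Rightarrow> 'a measure \<Rightarrow> (real \<Rightarrow> real \<Rightarrow> 'a \<Rightarrow> real) \<Rightarrow> (real \<Rightarrow> real \<Rightarrow> real \<Rightarrow> 'a \<Rightarrow> real)
      \<Rightarrow> real \<Rightarrow> real \<Rightarrow> real \<Rightarrow> real \<Rightarrow> real" where
  "truncated_cond_moment k M R F t r h L =
     (let P = joint_density M (F h L t) (R L t) in
       (LINT f:{-L..L}|lborel. f ^ k * P f r) / (LINT f:{-L..L}|lborel. P f r))"

definition cond_mean ::
    "'a measure \<Rightarrow> (real \<Rightarrow> real \<Rightarrow> 'a \<Rightarrow> real) \<Rightarrow> (real \<Rightarrow> real \<Rightarrow> real \<Rightarrow> 'a \<Rightarrow> real)
      \<Rightarrow> real \<Rightarrow> real \<Rightarrow> real \<Rightarrow> real" where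
  "cond_mean M R F t r h = Lim at_top (truncated_cond_moment 1 M R F t r h)"

definition cond_variance ::
    "'a measure \<Rightarrow> (real \<Rightarrow> real \<Rightarrow> 'a \<Rightarrow> real) \<Rightarrow> (real \<Rightarrow> real \<Rightarrow> real \<Rightarrow> 'a \<Rightarrow> real)
      \<Rightarrow> real \<Rightarrow> real \<Rightarrow> real \<Rightarrow> real" where
  "cond_variance M R F t r h =
     Lim at_top (truncated_cond_moment 2 M R F t r h) - (cond_mean M R F t r h)\<^sup>2"

definition Q_functional ::
    "'a measure \<Rightarrow> (real \<Rightarrow> real \<Rightarrow> 'a \<Rightarrow> real) \<Rightarrow> (real \<Rightarrow> real \<Rightarrow> real \<Rightarrow> 'a \<Rightarrow> real)
      \<Rightarrow> real \<Rightarrow> real \<Rightarrow> real \<Rightarrow> real \<Rightarrow> real" where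
  "Q_functional M R F \<gamma> t r h = cond_mean M R F t r h - \<gamma> * cond_variance M R F t r h"

end

theory Submission
  imports Defs
begin

text \<open>
  The Vasicek equation and the equation for the capital are solved pathwise, which writes
  \<open>(F, R)\<close> as an affine function of the initial rate, of a Wiener integral (integrated by
  parts, hence pathwise) against \<open>W2\<close>, and of \<open>W1\<close>.  Characteristic functions identify its law,
  Wiener integrals being limits of sums of independent increments.  Solving backwards from
  \<open>R(t) = r\<close> gives \<open>F(t) = \<mu>0 + \<mu>1 * r + Y\<close> with \<open>Y\<close> a centred Gaussian of variance \<open>V\<close>, so that
  \<open>2 L P\<^sub>L(f, r)\<close> is the density of \<open>N(\<mu>0 + \<mu>1 * r, V)\<close> at \<open>f\<close> times a factor which is bounded by,
  and tends to, the constant \<open>exp (- \<beta> * t)\<close>; the conditional moments therefore converge to those of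
  this normal law.
\<close>

section \<open>Characteristic functions of planar measures\<close>

text \<open>As \<open>L\<close> grows, the initial law rescaled by \<open>2 * L\<close> becomes
  Lebesgue measure. Translation by the noise preserves Lebesgue measure and the factor
  \<open>exp (\<beta> * t)\<close> only rescales it, so in the limit the observation R(t) = r says
  nothing about the noise, which keeps its unconditional law. This is why the limiting variance is
  the full variance \<open>V\<close> of \<open>Y\<close>, although \<open>Y\<close> may be
  correlated with the noise in R(t). Inserting the backward expression for R(0) into F adds the
  Wiener integral of \<open>exp (- \<beta> * s)\<close> to the term with -W2(t); hence the integrand
  \<open>exp (- \<beta> * s) - 1\<close>, whose squared norm produces \<phi>. For finite
  \<open>L\<close> the correlation is still visible: the noise of the rate is split into a multiple
  of \<open>Y\<close> and an independent remainder. Both \<open>Y\<close> and the remainder must be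
  nondegenerate for a continuous density to exist, and the conditional moments are defined through
  its pointwise values. The factors \<open>1 / (2 * L)\<close> and
  \<open>exp (- \<beta> * t)\<close> cancel in the quotients.\<close>

lemma finite_borel_measure_char_unique:
  fixes M N :: "real measure"
  assumes M: "finite_borel_measure M" and N: "finite_borel_measure N"
    and eq: "\<And>t. (CLINT x|M. iexp (t * x)) = (CLINT x|N. iexp (t * x))"
  shows "M = N"
proof -
  interpret M: finite_borel_measure M by fact
  interpret N: finite_borel_measure N by fact
  have [measurable_cong]: "sets M = sets borel" "sets N = sets borel"
    using M.M_is_borel N.M_is_borel by auto
  have sp: "space M = UNIV" "space N = UNIV"
    using sets_eq_imp_space_eq[OF M.M_is_borel] sets_eq_imp_space_eq[OF N.M_is_borel] by auto
  define m where "m = measure M UNIV"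
  \<comment> \<open>Frequency 0 gives equal total masses, so dividing both measures by the same
    \<open>m\<close> brings them within reach of Levy's theorem for probability measures.\<close>
  have mN: "m = measure N UNIV"
    using eq[of 0] by (simp add: m_def sp)
  show ?thesis
  proof (cases "m = 0")
    case True
    show ?thesis
    proof (rule measure_eqI)
      fix A assume A: "A \<in> sets M"
      have "emeasure M A \<le> emeasure M UNIV" "emeasure N A \<le> emeasure N UNIV"
        using A by (auto intro!: emeasure_mono)
      moreover have "emeasure M UNIV = 0" "emeasure N UNIV = 0"
        using True mN by (auto simp: m_def M.emeasure_eq_measure N.emeasure_eq_measure)
      ultimately show "emeasure M A = emeasure N A" by simp
    qed (simp add: M.M_is_borel N.M_is_borel)
  next
    case False
    then have m: "m > 0" by (simp add: m_def zero_less_measure_iff)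
    define S where "S K = density K (\<lambda>_::real. ennreal (1 / m))" for K :: "real measure"
    have rd: "real_distribution (S K)"
      if "finite_measure K" and [measurable_cong]: "sets K = sets borel" and "measure K UNIV = m" for K
    proof -
      interpret K: finite_measure K by fact
      have spK: "space K = UNIV" using sets_eq_imp_space_eq[OF that(2)] by simp
      have "emeasure (S K) (space (S K)) = 1"
        using that(3) m unfolding S_def
        by (simp add: emeasure_density spK nn_integral_cmult K.emeasure_eq_measure
            ennreal_mult[symmetric])
      then show ?thesis
        by (intro real_distribution.intro prob_spaceI real_distribution_axioms.intro)
           (auto simp: S_def that(2))
    qed
    have ch: "char (S K) t = (1 / m) *\<^sub>R (CLINT x|K. iexp (t * x))"
      if [measurable_cong]: "sets K = sets borel" for K t
      unfolding S_def char_def using m by (subst integral_density) auto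
    have "S M = S N"
    proof (rule Levy_uniqueness)
      show "real_distribution (S M)" "real_distribution (S N)"
        by (auto intro!: rd simp: m_def M.finite_measure_axioms N.finite_measure_axioms
            M.M_is_borel N.M_is_borel mN[unfolded m_def])
      show "char (S M) = char (S N)"
        by (intro ext) (simp only: ch[OF M.M_is_borel] ch[OF N.M_is_borel] eq)
    qed
    show ?thesis
    proof (rule measure_eqI)
      fix A assume "A \<in> sets M"
      then have [measurable]: "A \<in> sets borel" by (simp add: M.M_is_borel)
      have e: "emeasure K A = ennreal m * emeasure (S K) A"
        if [measurable_cong]: "sets K = sets borel" for K
      proof -
        have "A \<in> sets K" using that by simp
        then show ?thesis using m
        by (simp add: S_def emeasure_density nn_integral_cmult_indicator
            mult.assoc[symmetric] ennreal_mult[symmetric])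
      qed
      show "emeasure M A = emeasure N A"
        using \<open>S M = S N\<close> by (simp add: e M.M_is_borel N.M_is_borel)
    qed (simp add: M.M_is_borel N.M_is_borel)
  qed
qed

text \<open>Reweight by \<open>g\<close> and push forward along \<open>p\<close>: the result is a
  finite measure on the line whose characteristic function at \<open>u\<close> is the integral in
  \<open>eq\<close>. Nonnegativity of \<open>g\<close> makes it a measure, and the bound
  \<open>C\<close> makes it finite.\<close>

lemma weighted_char_unique:
  fixes M N :: "'a measure" and p g :: "'a \<Rightarrow> real"
  assumes M: "finite_measure M" and N: "finite_measure N" and sets: "sets N = sets M"
    and p [measurable]: "p \<in> borel_measurable M" and g [measurable]: "g \<in> borel_measurable M"
    and bound: "\<And>z. 0 \<le> g z" "\<And>z. g z \<le> C"
    and eq: "\<And>u. (CLINT z|M. g z *\<^sub>R iexp (u * p z)) = (CLINT z|N. g z *\<^sub>R iexp (u * p z))"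
    and A [measurable]: "A \<in> sets borel"
  shows "(LINT z|M. g z * indicator A (p z)) = (LINT z|N. g z * indicator A (p z))"
proof -
  define D where "D K = distr (density K (\<lambda>z. ennreal (g z))) borel p" for K :: "'a measure"
  have fin: "finite_borel_measure (D K)"
    if K: "finite_measure K" and [measurable_cong]: "sets K = sets M" for K
  proof -
    interpret K: finite_measure K by fact
    have "(\<integral>\<^sup>+ z. ennreal (g z) \<partial>K) \<le> (\<integral>\<^sup>+ z. ennreal C \<partial>K)"
      by (intro nn_integral_mono ennreal_leI bound)
    also have "\<dots> < \<infinity>" by (simp add: ennreal_mult_less_top K.emeasure_eq_measure)
    finally have "emeasure (D K) (space (D K)) \<noteq> \<infinity>"
      unfolding D_def by (simp add: emeasure_distr emeasure_density cong: nn_integral_cong)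
    then show ?thesis
      by (intro finite_borel_measure.intro finite_measureI finite_borel_measure_axioms.intro)
         (auto simp: D_def)
  qed
  have int: "(CLINT x|D K. iexp (u * x)) = (CLINT z|K. g z *\<^sub>R iexp (u * p z))"
    if [measurable_cong]: "sets K = sets M" for K u
    unfolding D_def using bound by (simp add: integral_distr integral_density)
  have ind: "(LINT x|D K. indicator A x) = (LINT z|K. g z * indicator A (p z))"
    if [measurable_cong]: "sets K = sets M" for K
    unfolding D_def using bound by (subst integral_distr; simp add: integral_density del: integral_indicator)
  have "D M = D N"
  proof (rule finite_borel_measure_char_unique)
    show "finite_borel_measure (D M)" "finite_borel_measure (D N)"
      using M N sets by (auto intro!: fin)
    show "(CLINT x|D M. iexp (u * x)) = (CLINT x|D N. iexp (u * x))" for u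
      by (simp only: int[OF refl] int[OF sets] eq)
  qed
  then show ?thesis using ind[of M] ind[OF sets] by simp
qed

text \<open>Product-to-sum formulas turn a trigonometric weight in one coordinate into planar
  characters, whose integrals are known to agree.\<close>

lemma iexp_times_cos: "cos b *\<^sub>R iexp a = (iexp (a + b) + iexp (a - b)) /\<^sub>R 2"
  by (simp add: exp_eq_polar complex_eq_iff cos_add cos_diff sin_add sin_diff field_simps)

lemma iexp_times_sin: "sin b *\<^sub>R iexp a = (- \<i> / 2) * (iexp (a + b) - iexp (a - b))"
  by (simp add: exp_eq_polar complex_eq_iff cos_add cos_diff sin_add sin_diff field_simps)

text \<open>
  The one-dimensional theorem is applied to each coordinate in turn, the other coordinate
  entering through a weight; the weights \<open>2 + cos\<close> and \<open>2 + sin\<close> keep the measures positive.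
\<close>

lemma pair_char_unique:
  fixes M N :: "(real \<times> real) measure"
  assumes M: "finite_measure M" and N: "finite_measure N"
    and sM: "sets M = sets (borel \<Otimes>\<^sub>M borel)" and sN: "sets N = sets (borel \<Otimes>\<^sub>M borel)"
    and eq: "\<And>u v. (CLINT z|M. iexp (u * fst z + v * snd z)) = (CLINT z|N. iexp (u * fst z + v * snd z))"
  shows "M = N"
proof -
  interpret M: finite_measure M by fact
  interpret N: finite_measure N by fact
  note [measurable_cong] = sM sN
  have iM: "integrable M (\<lambda>z. iexp (u * fst z + v * snd z))" for u v
    by (rule M.integrable_const_bound[where B=1]) auto
  have iN: "integrable N (\<lambda>z. iexp (u * fst z + v * snd z))" for u v
    by (rule N.integrable_const_bound[where B=1]) auto
  have iM': "integrable M (\<lambda>z. iexp (u * fst z - v * snd z))" for u v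
    by (rule M.integrable_const_bound[where B=1]) auto
  have iN': "integrable N (\<lambda>z. iexp (u * fst z - v * snd z))" for u v
    by (rule N.integrable_const_bound[where B=1]) auto
  have iM0: "integrable M (\<lambda>z. iexp (u * fst z))" for u
    by (rule M.integrable_const_bound[where B=1]) auto
  have iN0: "integrable N (\<lambda>z. iexp (u * fst z))" for u
    by (rule N.integrable_const_bound[where B=1]) auto
  have eq': "(CLINT z|M. iexp (u * fst z - v * snd z)) = (CLINT z|N. iexp (u * fst z - v * snd z))" for u v
    using eq[of u "- v"] by simp
  have eq0: "(CLINT z|M. iexp (u * fst z)) = (CLINT z|N. iexp (u * fst z))" for u
    using eq[of u 0] by simp
  have c: "(LINT z|M. (2 + cos (v * snd z)) * indicator A (fst z)) =
      (LINT z|N. (2 + cos (v * snd z)) * indicator A (fst z))"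
    if [measurable]: "A \<in> sets borel" for A v
  proof (rule weighted_char_unique[OF M N _ _ _ _ _ _ that, where C=3])
    show "(CLINT z|M. (2 + cos (v * snd z)) *\<^sub>R iexp (u * fst z)) =
      (CLINT z|N. (2 + cos (v * snd z)) *\<^sub>R iexp (u * fst z))" for u
      unfolding scaleR_add_left iexp_times_cos
      using iM iN iM' iN' iM0 iN0 eq[of u v] eq'[of u v] eq0[of u] by simp
    show "0 \<le> 2 + cos (v * snd z)" "2 + cos (v * snd z) \<le> 3" for z :: "real \<times> real"
      using cos_ge_minus_one[of "v * snd z"] cos_le_one[of "v * snd z"] by linarith+
  qed (auto simp: sM sN)
  have s: "(LINT z|M. (2 + sin (v * snd z)) * indicator A (fst z)) =
      (LINT z|N. (2 + sin (v * snd z)) * indicator A (fst z))"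
    if [measurable]: "A \<in> sets borel" for A v
  proof (rule weighted_char_unique[OF M N _ _ _ _ _ _ that, where C=3])
    show "(CLINT z|M. (2 + sin (v * snd z)) *\<^sub>R iexp (u * fst z)) =
      (CLINT z|N. (2 + sin (v * snd z)) *\<^sub>R iexp (u * fst z))" for u
      unfolding scaleR_add_left iexp_times_sin
      using iM iN iM' iN' iM0 iN0 eq[of u v] eq'[of u v] eq0[of u] by simp
    show "0 \<le> 2 + sin (v * snd z)" "2 + sin (v * snd z) \<le> 3" for z :: "real \<times> real"
      using sin_ge_minus_one[of "v * snd z"] sin_le_one[of "v * snd z"] by linarith+
  qed (auto simp: sM sN)
  \<comment> \<open>The roles of the coordinates are exchanged: the indicator of \<open>A\<close> in
    the first one is now the weight, and the identities \<open>c\<close> and \<open>s\<close> supply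
    the characters in the second one.\<close>
  have prod: "(LINT z|M. indicator A (fst z) * indicator B (snd z) :: real) =
      (LINT z|N. indicator A (fst z) * indicator B (snd z))"
    if [measurable]: "A \<in> sets borel" "B \<in> sets borel" for A B :: "real set"
  proof (rule weighted_char_unique[OF M N _ _ _ _ _ _ that(2), where C=1])
    fix v
    have iK: "integrable K (\<lambda>z. indicator A (fst z) :: real)"
        "integrable K (\<lambda>z. cos (v * snd z) * indicator A (fst z))"
        "integrable K (\<lambda>z. sin (v * snd z) * indicator A (fst z))"
      if "finite_measure K" and [measurable_cong]: "sets K = sets (borel \<Otimes>\<^sub>M borel)"
      for K :: "(real \<times> real) measure"
      by (auto intro!: finite_measure.integrable_const_bound[OF that(1), where B=1]
          simp: indicator_def abs_mult)
    \<comment> \<open>Weight 1; subtracting this case twice removes the constant 2 that kept the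
      trigonometric weights positive.\<close>
    have one: "(LINT z|M. indicator A (fst z) :: real) = (LINT z|N. indicator A (fst z))"
      by (rule weighted_char_unique[OF M N _ _ _ _ _ _ that(1),
            where g="\<lambda>_. 1" and C=1, simplified])
         (use eq0 in \<open>auto simp: sM sN\<close>)
    have cs: "(LINT z|M. cos (v * snd z) * indicator A (fst z)) =
        (LINT z|N. cos (v * snd z) * indicator A (fst z))"
      using c[OF that(1), of v] iK[OF M sM] iK[OF N sN] one
      by (simp add: distrib_right)
    have sn: "(LINT z|M. sin (v * snd z) * indicator A (fst z)) =
        (LINT z|N. sin (v * snd z) * indicator A (fst z))"
      using s[OF that(1), of v] iK[OF M sM] iK[OF N sN] one
      by (simp add: distrib_right)
    have ch: "(CLINT z|K. indicator A (fst z) *\<^sub>R iexp (v * snd z)) =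
        complex_of_real (LINT z|K. cos (v * snd z) * indicator A (fst z)) +
        \<i> * complex_of_real (LINT z|K. sin (v * snd z) * indicator A (fst z))"
      if "finite_measure K" and sK[measurable_cong]: "sets K = sets (borel \<Otimes>\<^sub>M borel)"
      for K :: "(real \<times> real) measure"
    proof -
      have "(CLINT z|K. indicator A (fst z) *\<^sub>R iexp (v * snd z)) =
          (CLINT z|K. complex_of_real (cos (v * snd z) * indicator A (fst z)) +
             \<i> * complex_of_real (sin (v * snd z) * indicator A (fst z)))"
        by (intro Bochner_Integration.integral_cong)
           (auto simp: exp_eq_polar complex_eq_iff)
      also have "\<dots> = (CLINT z|K. complex_of_real (cos (v * snd z) * indicator A (fst z))) +
          (CLINT z|K. \<i> * complex_of_real (sin (v * snd z) * indicator A (fst z)))"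
        using iK[OF that] by (intro Bochner_Integration.integral_add integrable_mult_right integrable_of_real)
      finally show ?thesis
        by (simp only: integral_mult_right_zero integral_complex_of_real)
    qed
    show "(CLINT z|M. indicator A (fst z) *\<^sub>R iexp (v * snd z)) =
        (CLINT z|N. indicator A (fst z) *\<^sub>R iexp (v * snd z))"
      by (simp only: ch[OF M sM] ch[OF N sN] cs sn)
  qed (auto simp: sM sN indicator_def)
  show ?thesis
  proof (rule measure_eqI_generator_eq[OF Int_stable_pair_measure_generator])
    show "{a \<times> b |a b. a \<in> sets borel \<and> b \<in> sets borel} \<subseteq> Pow (UNIV :: (real \<times> real) set)" by auto
    show "sets M = sigma_sets UNIV {a \<times> b |a b. a \<in> sets borel \<and> b \<in> sets borel}"
      "sets N = sigma_sets UNIV {a \<times> b |a b. a \<in> sets borel \<and> b \<in> sets borel}"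
      by (simp_all add: sM sN sets_pair_measure)
    show "range (\<lambda>_::nat. UNIV) \<subseteq> {a \<times> b |a b. a \<in> sets (borel :: real measure) \<and> b \<in> sets (borel :: real measure)}"
      by (auto intro!: exI[of _ UNIV])
    fix X :: "(real \<times> real) set" assume "X \<in> {a \<times> b |a b. a \<in> sets borel \<and> b \<in> sets borel}"
    then obtain A B where X: "X = A \<times> B" and [measurable]: "A \<in> sets borel" "B \<in> sets borel" by auto
    have XM: "X \<in> sets M" "X \<in> sets N" by (auto simp: X sM sN)
    have "measure K X = (LINT z|K. indicator A (fst z) * indicator B (snd z) :: real)"
      if [measurable_cong]: "sets K = sets (borel \<Otimes>\<^sub>M borel)" for K
    proof -
      have "measure K X = (LINT z|K. indicator X z)"
        using sets.sets_into_space[of X K] that X by (simp add: Int_absorb1 Int_absorb2)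
      also have "\<dots> = (LINT z|K. indicator A (fst z) * indicator B (snd z))"
        by (intro Bochner_Integration.integral_cong) (auto simp: X indicator_def)
      finally show ?thesis .
    qed
    then show "emeasure M X = emeasure N X"
      using prod by (simp add: M.emeasure_eq_measure N.emeasure_eq_measure sM sN)
  qed (auto simp: M.emeasure_eq_measure)
qed

section \<open>Riemann sums and a linear integral equation\<close>

lemma integral_equidistant_cells:
  fixes h :: "real \<Rightarrow> real" and t :: real and m n :: nat
  assumes "0 \<le> t" and cont: "continuous_on {0..t} h" and "m \<le> n"
  shows "(\<Sum>k<m. integral {t * k / n..t * Suc k / n} h) = integral {0..t * m / n} h"
  using \<open>m \<le> n\<close>
proof (induction m)
  case (Suc m)
  have "t * Suc m \<le> t * n" using Suc.prems \<open>0 \<le> t\<close> by (intro mult_left_mono) auto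
  then have le: "t * Suc m / n \<le> t" using Suc.prems by (simp add: divide_le_eq)
  have "integral {0..t * m / n} h + integral {t * m / n..t * Suc m / n} h = integral {0..t * Suc m / n} h"
    using \<open>0 \<le> t\<close> le
    by (intro Henstock_Kurzweil_Integration.integral_combine integrable_continuous_interval
          continuous_on_subset[OF cont])
       (auto intro!: divide_right_mono mult_left_mono)
  then show ?case using Suc by simp
qed simp

text \<open>Freezing \<open>g\<close> at a tag costs, on each cell, at most the modulus of
  continuity of \<open>g\<close> times the bound on \<open>d\<close> times the mesh. The tags are
  left free because right endpoints are used for the squared norm of an integrand and left endpoints
  for summation by parts.\<close>

lemma weighted_riemann_sum_tendsto:
  fixes g d :: "real \<Rightarrow> real" and t :: real
  assumes t: "0 < t" and g: "continuous_on {0..t} g" and d: "continuous_on {0..t} d"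
    and tag: "\<And>n k. k < n \<Longrightarrow> \<xi> n k \<in> {t * real k / real n..t * real (Suc k) / real n}"
  shows "(\<lambda>n. \<Sum>k<n. g (\<xi> n k) * integral {t * k / n..t * Suc k / n} d)
    \<longlonglongrightarrow> integral {0..t} (\<lambda>s. g s * d s)"
proof (rule LIMSEQ_I)
  fix e :: real assume e: "0 < e"
  have "bounded (d ` {0..t})" by (intro compact_imp_bounded compact_continuous_image d) auto
  then obtain D where D: "0 < D" "\<And>x. x \<in> {0..t} \<Longrightarrow> \<bar>d x\<bar> \<le> D"
    by (auto simp: bounded_pos)
  \<comment> \<open>With this choice the cell errors, each at most \<open>e' * D * (t / n)\<close>,
    add up to \<open>e / 2\<close>.\<close>
  define e' where "e' = e / (2 * D * t)"
  have e': "0 < e'" using e D t by (simp add: e'_def)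
  have "uniformly_continuous_on {0..t} g" using g by (intro compact_uniformly_continuous) auto
  then obtain \<delta> where \<delta>: "0 < \<delta>"
      "\<And>x y. x \<in> {0..t} \<Longrightarrow> y \<in> {0..t} \<Longrightarrow> \<bar>y - x\<bar> < \<delta> \<Longrightarrow> \<bar>g y - g x\<bar> < e'"
    using e' unfolding uniformly_continuous_on_def dist_real_def by metis
  obtain n0 :: nat where n0: "t / \<delta> < n0" using reals_Archimedean2 by blast
  show "\<exists>no. \<forall>n\<ge>no. norm ((\<Sum>k<n. g (\<xi> n k) * integral {t * k / n..t * Suc k / n} d)
      - integral {0..t} (\<lambda>s. g s * d s)) < e"
  proof (intro exI[of _ "Suc n0"] allI impI)
    fix n assume n: "Suc n0 \<le> n"
    have npos: "0 < real n" using n by simp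
    have mesh: "t / n < \<delta>"
    proof -
      have "t / \<delta> < n" using n0 n by linarith
      then show ?thesis using \<delta>(1) npos by (simp add: field_simps)
    qed
    let ?C = "\<lambda>k. {t * real k / n..t * real (Suc k) / n}"
    have cell: "?C k \<subseteq> {0..t}" if "k < n" for k
    proof -
      have "t * real (Suc k) \<le> t * real n" using that t by (intro mult_left_mono) auto
      then have "t * real (Suc k) / n \<le> t" using npos by (simp add: divide_le_eq)
      then show ?thesis using t by auto
    qed
    have len: "t * real (Suc k) / n - t * real k / n = t / n" for k
      by (simp add: diff_divide_distrib[symmetric] algebra_simps)
    have diff: "\<bar>g (\<xi> n k) * integral (?C k) d - integral (?C k) (\<lambda>s. g s * d s)\<bar> \<le> e' * D * (t / n)"
      if k: "k < n" for k
    proof -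
      note cont = continuous_on_subset[OF g cell[OF k]] continuous_on_subset[OF d cell[OF k]]
      have "g (\<xi> n k) * integral (?C k) d - integral (?C k) (\<lambda>s. g s * d s)
          = integral (?C k) (\<lambda>s. (g (\<xi> n k) - g s) * d s)"
        unfolding left_diff_distrib
        by (subst Henstock_Kurzweil_Integration.integral_diff)
           ((intro integrable_continuous_interval continuous_intros cont)+, simp)
      moreover have "norm (integral (?C k) (\<lambda>s. (g (\<xi> n k) - g s) * d s))
          \<le> e' * D * (t * real (Suc k) / n - t * real k / n)"
      proof (rule integral_bound)
        show "t * real k / n \<le> t * real (Suc k) / n" using t npos by (intro divide_right_mono mult_left_mono) auto
        show "continuous_on (?C k) (\<lambda>s. (g (\<xi> n k) - g s) * d s)"
          by (intro continuous_intros cont)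
        fix s assume s: "s \<in> ?C k"
        have "\<bar>\<xi> n k - s\<bar> < \<delta>" using tag[OF k] s len[of k] mesh by auto
        then have "\<bar>g (\<xi> n k) - g s\<bar> \<le> e'"
          using \<delta>(2)[of s "\<xi> n k"] tag[OF k] s cell[OF k] by fastforce
        then show "norm ((g (\<xi> n k) - g s) * d s) \<le> e' * D"
          using D(2)[of s] s cell[OF k] e' by (auto simp: abs_mult intro!: mult_mono)
      qed
      ultimately show ?thesis by (simp only: len real_norm_def)
    qed
    have "integral {0..t} (\<lambda>s. g s * d s) = (\<Sum>k<n. integral (?C k) (\<lambda>s. g s * d s))"
      using integral_equidistant_cells[of t "\<lambda>s. g s * d s" n n] t npos
      by (simp add: continuous_on_mult g d)
    then have "norm ((\<Sum>k<n. g (\<xi> n k) * integral (?C k) d) - integral {0..t} (\<lambda>s. g s * d s))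
        = \<bar>\<Sum>k<n. g (\<xi> n k) * integral (?C k) d - integral (?C k) (\<lambda>s. g s * d s)\<bar>"
      by (simp add: sum_subtractf)
    also have "\<dots> \<le> (\<Sum>k<n. e' * D * (t / n))"
      by (rule order_trans[OF sum_abs]) (intro sum_mono diff, simp)
    also have "\<dots> = e / 2" using npos D t by (simp add: e'_def)
    finally show "norm ((\<Sum>k<n. g (\<xi> n k) * integral (?C k) d) - integral {0..t} (\<lambda>s. g s * d s)) < e"
      using e by linarith
  qed
qed

lemma square_riemann_sum_tendsto:
  fixes c :: "real \<Rightarrow> real" and t :: real
  assumes t: "0 < t" and c: "continuous_on {0..t} c"
  shows "(\<lambda>n. \<Sum>k<n. (c (t * Suc k / n))\<^sup>2 * (t * Suc k / n - t * k / n))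
    \<longlonglongrightarrow> integral {0..t} (\<lambda>s. (c s)\<^sup>2)"
proof -
  have "(\<lambda>n. \<Sum>k<n. (c (t * Suc k / n))\<^sup>2 * integral {t * k / n..t * Suc k / n} (\<lambda>_. 1))
      \<longlonglongrightarrow> integral {0..t} (\<lambda>s. (c s)\<^sup>2 * 1)"
    using t by (intro weighted_riemann_sum_tendsto continuous_intros c)
      (auto intro!: divide_right_mono mult_left_mono)
  moreover have "t * real k / real n \<le> t * real (Suc k) / real n" for k n :: nat
    using t by (intro divide_right_mono mult_left_mono) auto
  ultimately show ?thesis by simp
qed

section \<open>Pathwise Wiener integrals by Abel summation\<close>

lemma summation_by_parts_increments:
  fixes c w :: "nat \<Rightarrow> 'a::comm_ring"
  shows "(\<Sum>k<n. c (Suc k) * (w (Suc k) - w k)) = c n * w n - c 0 * w 0 - (\<Sum>k<n. w k * (c (Suc k) - c k))"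
  by (induction n) (auto simp: algebra_simps)

text \<open>A Brownian path need not have bounded variation, so its increments are moved onto the
  smooth factor \<open>c\<close>, where they become integrals of \<open>c'\<close>. The remaining
  sum is an ordinary weighted Riemann sum, and convergence holds for every continuous
  \<open>w\<close> that starts at 0.\<close>

lemma wiener_sum_tendsto:
  fixes c c' w :: "real \<Rightarrow> real" and t :: real
  assumes t: "0 < t" and c: "\<And>s. s \<in> {0..t} \<Longrightarrow> (c has_real_derivative c' s) (at s within {0..t})"
    and c': "continuous_on {0..t} c'" and w: "continuous_on {0..t} w" and w0: "w 0 = 0"
  shows "(\<lambda>n. \<Sum>k<n. c (t * Suc k / n) * (w (t * Suc k / n) - w (t * k / n)))
    \<longlonglongrightarrow> c t * w t - integral {0..t} (\<lambda>s. w s * c' s)"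
proof -
  have ftc: "c (t * real (Suc k) / n) - c (t * real k / n) = integral {t * k / n..t * Suc k / n} c'"
    if "k < n" for n k :: nat
  proof -
    have npos: "0 < real n" using that by simp
    have "t * real (Suc k) \<le> t * real n" using that t by (intro mult_left_mono) auto
    then have "t * real (Suc k) / n \<le> t" using npos by (simp add: divide_le_eq)
    then have sub: "{t * real k / n..t * real (Suc k) / n} \<subseteq> {0..t}" using t by auto
    have "(c' has_integral (c (t * Suc k / n) - c (t * k / n))) {t * k / n..t * Suc k / n}"
    proof (rule fundamental_theorem_of_calculus)
      show "t * real k / n \<le> t * real (Suc k) / n" using t npos by (intro divide_right_mono mult_left_mono) auto
      fix x assume "x \<in> {t * real k / n..t * real (Suc k) / n}"
      then have "(c has_real_derivative c' x) (at x within {0..t})" using c sub by blast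
      then show "(c has_vector_derivative c' x) (at x within {t * real k / n..t * real (Suc k) / n})"
        unfolding has_real_derivative_iff_has_vector_derivative
        by (rule has_vector_derivative_within_subset[OF _ sub])
    qed
    then show ?thesis by (simp add: integral_unique)
  qed
  have "(\<lambda>n. \<Sum>k<n. w (t * real k / n) * integral {t * k / n..t * Suc k / n} c')
      \<longlonglongrightarrow> integral {0..t} (\<lambda>s. w s * c' s)"
    using t by (intro weighted_riemann_sum_tendsto w c') (auto intro!: divide_right_mono mult_left_mono)
  then have lim: "(\<lambda>n. c t * w t - (\<Sum>k<n. w (t * real k / n) * integral {t * k / n..t * Suc k / n} c'))
      \<longlonglongrightarrow> c t * w t - integral {0..t} (\<lambda>s. w s * c' s)"
    by (intro tendsto_intros)
  show ?thesis
  \<comment> \<open>For \<open>n = 0\<close> the last partition point \<open>t * n / n\<close> is 0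
    by the convention for division by zero; from \<open>n = 1\<close> on it is
    \<open>t\<close>.\<close>
  proof (rule Lim_transform_eventually[OF lim], intro eventually_sequentiallyI[of 1])
    fix n :: nat assume n: "1 \<le> n"
    have "(\<Sum>k<n. c (t * real (Suc k) / n) * (w (t * real (Suc k) / n) - w (t * real k / n)))
      = c (t * real n / n) * w (t * real n / n) - c (t * real 0 / n) * w (t * real 0 / n)
        - (\<Sum>k<n. w (t * real k / n) * (c (t * real (Suc k) / n) - c (t * real k / n)))"
      by (rule summation_by_parts_increments[of "\<lambda>k. c (t * real k / n)" "\<lambda>k. w (t * real k / n)"])
    also have "(\<Sum>k<n. w (t * real k / n) * (c (t * real (Suc k) / n) - c (t * real k / n)))
        = (\<Sum>k<n. w (t * real k / n) * integral {t * k / n..t * Suc k / n} c')"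
      by (intro sum.cong refl) (simp only: ftc lessThan_iff)
    finally show "c t * w t - (\<Sum>k<n. w (t * real k / n) * integral {t * k / n..t * Suc k / n} c')
      = (\<Sum>k<n. c (t * Suc k / n) * (w (t * Suc k / n) - w (t * k / n)))"
      using n w0 by simp
  qed
qed

text \<open>Variation of constants. The path \<open>x\<close> may be nowhere differentiable, but its
  drift part \<open>Y\<close> is differentiable with \<open>Y' = B + \<beta> * x\<close>, so the
  integrating factor is applied to \<open>Y\<close> instead of \<open>x\<close>. The second formula
  is the equation itself solved for the integral of \<open>x\<close>.\<close>

lemma linear_integral_equation:
  fixes x w :: "real \<Rightarrow> real"
  assumes t: "0 \<le> t" and \<beta>: "\<beta> \<noteq> 0"
    and x: "continuous_on {0..t} x" and w: "continuous_on {0..t} w"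
    and eq: "\<And>s. s \<in> {0..t} \<Longrightarrow> x s = \<rho> + integral {0..s} (\<lambda>s. B + \<beta> * x s) + \<nu> * w s"
  shows "x t = exp (\<beta> * t) * \<rho> + B * (exp (\<beta> * t) - 1) / \<beta>
      + \<nu> * (w t + \<beta> * integral {0..t} (\<lambda>s. exp (\<beta> * (t - s)) * w s))"
    and "integral {0..t} x = (x t - \<rho> - B * t - \<nu> * w t) / \<beta>"
proof -
  define Y where "Y s = integral {0..s} (\<lambda>s. B + \<beta> * x s)" for s
  \<comment> \<open>Eliminating \<open>x\<close> gives \<open>Y' = \<beta> * (Y + B / \<beta> +
    \<rho>) + \<beta> * \<nu> * w\<close>; the factor \<open>exp (- \<beta> * s)\<close> leaves only
    the term with \<open>w\<close> in the derivative of \<open>G\<close>.\<close>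
  define G where "G s = exp (- \<beta> * s) * (Y s + B / \<beta> + \<rho>)" for s
  have "Y t = integral {0..t} (\<lambda>s. B) + integral {0..t} (\<lambda>s. \<beta> * x s)"
    unfolding Y_def
    by (intro Henstock_Kurzweil_Integration.integral_add integrable_continuous_interval continuous_intros x)
  then have Yt: "Y t = B * t + \<beta> * integral {0..t} x" using t by simp
  have xt: "x t = \<rho> + Y t + \<nu> * w t" using eq[of t] t by (simp add: Y_def)
  show "integral {0..t} x = (x t - \<rho> - B * t - \<nu> * w t) / \<beta>"
    using \<beta> by (simp add: xt Yt)
  have "((\<lambda>s. exp (- \<beta> * s) * (\<beta> * \<nu> * w s)) has_integral G t - G 0) {0..t}"
  proof (rule fundamental_theorem_of_calculus[OF t])
    fix s assume s: "s \<in> {0..t}"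
    have "(Y has_real_derivative B + \<beta> * x s) (at s within {0..t})"
      unfolding Y_def[abs_def]
      using s by (intro integral_has_real_derivative continuous_intros x)
    then have "(G has_real_derivative
        exp (- \<beta> * s) * (B + \<beta> * x s) + (exp (- \<beta> * s) * (- \<beta>)) * (Y s + B / \<beta> + \<rho>))
        (at s within {0..t})"
      unfolding G_def[abs_def] by (auto intro!: derivative_eq_intros)
    moreover have "x s = \<rho> + Y s + \<nu> * w s" using eq[OF s] by (simp add: Y_def)
    ultimately show "(G has_vector_derivative exp (- \<beta> * s) * (\<beta> * \<nu> * w s)) (at s within {0..t})"
      unfolding has_real_derivative_iff_has_vector_derivative[symmetric]
      using \<beta> by (simp add: field_simps)
  qed
  then have "integral {0..t} (\<lambda>s. exp (- \<beta> * s) * (\<beta> * \<nu> * w s)) = G t - G 0"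
    by (rule integral_unique)
  moreover have "integral {0..t} (\<lambda>s. exp (- \<beta> * s) * (\<beta> * \<nu> * w s))
      = \<beta> * \<nu> * integral {0..t} (\<lambda>s. exp (- \<beta> * s) * w s)"
    by (simp add: mult_ac flip: Henstock_Kurzweil_Integration.integral_mult_right)
  ultimately have G: "G t = G 0 + \<beta> * \<nu> * integral {0..t} (\<lambda>s. exp (- \<beta> * s) * w s)"
    by simp
  have I: "integral {0..t} (\<lambda>s. exp (\<beta> * (t - s)) * w s)
      = exp (\<beta> * t) * integral {0..t} (\<lambda>s. exp (- \<beta> * s) * w s)"
    by (simp add: algebra_simps exp_diff exp_minus divide_inverse flip: Henstock_Kurzweil_Integration.integral_mult_right)
  have "Y t = exp (\<beta> * t) * G t - B / \<beta> - \<rho>"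
    by (simp add: G_def exp_minus field_simps)
  also have "\<dots> = exp (\<beta> * t) * (B / \<beta> + \<rho>) - B / \<beta> - \<rho>
      + \<beta> * \<nu> * integral {0..t} (\<lambda>s. exp (\<beta> * (t - s)) * w s)"
    unfolding G I by (simp add: G_def Y_def algebra_simps)
  finally show "x t = exp (\<beta> * t) * \<rho> + B * (exp (\<beta> * t) - 1) / \<beta>
      + \<nu> * (w t + \<beta> * integral {0..t} (\<lambda>s. exp (\<beta> * (t - s)) * w s))"
    unfolding xt by (simp add: algebra_simps diff_divide_distrib)
qed

section \<open>Wiener integrals\<close>

context prob_space
begin

section \<open>Gaussian characters and their limits along partitions\<close>

lemma normal_distributed_char:
  assumes X: "distributed M lborel X (\<lambda>x. ennreal (normal_density 0 \<sigma> x))" and \<sigma>: "0 < \<sigma>"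
  shows "(CLINT \<omega>|M. iexp (u * X \<omega>)) = of_real (exp (- (u\<^sup>2 * \<sigma>\<^sup>2) / 2))"
proof -
  have [measurable]: "X \<in> borel_measurable M" using distributed_measurable[OF X] by simp
  have "distributed M lborel (\<lambda>\<omega>. (X \<omega> - 0) / \<sigma>) (\<lambda>x. ennreal (std_normal_density x))"
    using X normal_standard_normal_convert[OF \<sigma>, of X 0] by simp
  then have "distr M lborel (\<lambda>\<omega>. X \<omega> / \<sigma>) = std_normal_distribution"
    by (simp add: distributed_def)
  moreover have "distr M lborel (\<lambda>\<omega>. X \<omega> / \<sigma>) = distr M borel (\<lambda>\<omega>. X \<omega> / \<sigma>)"
    by (intro distr_cong) auto
  ultimately have "char (distr M borel (\<lambda>\<omega>. X \<omega> / \<sigma>)) (u * \<sigma>) = of_real (exp (- ((u * \<sigma>)\<^sup>2) / 2))"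
    by (simp only: char_std_normal_distribution)
  moreover have "char (distr M borel (\<lambda>\<omega>. X \<omega> / \<sigma>)) (u * \<sigma>) = (CLINT \<omega>|M. iexp (u * \<sigma> * (X \<omega> / \<sigma>)))"
    unfolding char_def by (subst integral_distr) auto
  moreover have "u * \<sigma> * (X \<omega> / \<sigma>) = u * X \<omega>" for \<omega> using \<sigma> by simp
  ultimately show ?thesis by (simp only: power_mult_distrib)
qed

lemma brownian_increment_char:
  assumes W: "brownian_motion W" and "0 \<le> s" "s < t"
  shows "(CLINT \<omega>|M. iexp (u * (W t \<omega> - W s \<omega>))) = of_real (exp (- (u\<^sup>2 * (t - s)) / 2))"
proof -
  have "distributed M lborel (\<lambda>\<omega>. W t \<omega> - W s \<omega>) (\<lambda>x. ennreal (normal_density 0 (sqrt (t - s)) x))"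
    using W assms(2,3) by (simp add: brownian_motion_def)
  from normal_distributed_char[OF this, of u] show ?thesis using \<open>s < t\<close> by simp
qed

lemma brownian_char:
  assumes W: "brownian_motion W" and "0 < t"
  shows "(CLINT \<omega>|M. iexp (u * W t \<omega>)) = of_real (exp (- (u\<^sup>2 * t) / 2))"
proof -
  have [measurable]: "W t \<in> borel_measurable M" "W 0 \<in> borel_measurable M"
    using W \<open>0 < t\<close> by (auto simp: brownian_motion_def)
  have "AE \<omega> in M. W 0 \<omega> = 0" using W by (simp add: brownian_motion_def)
  then have "(CLINT \<omega>|M. iexp (u * W t \<omega>)) = (CLINT \<omega>|M. iexp (u * (W t \<omega> - W 0 \<omega>)))"
    by (intro integral_cong_AE) auto
  then show ?thesis using brownian_increment_char[OF W, of 0 t u] \<open>0 < t\<close> by simp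
qed

lemma brownian_sum_char:
  fixes c :: "real \<Rightarrow> real" and t :: real
  assumes W: "brownian_motion W" and t: "0 < t"
  shows "(CLINT \<omega>|M. iexp (\<Sum>k<n. c (t * Suc k / n) * (W (t * Suc k / n) \<omega> - W (t * k / n) \<omega>)))
    = of_real (exp (- (\<Sum>k<n. (c (t * Suc k / n))\<^sup>2 * (t * Suc k / n - t * k / n)) / 2))"
proof -
  let ?\<tau> = "\<lambda>k. t * real k / real n"
  have mono: "?\<tau> k \<le> ?\<tau> (Suc k)" for k using t by (intro divide_right_mono mult_left_mono) auto
  have less: "?\<tau> k < ?\<tau> (Suc k)" if "k < n" for k using t that by (simp add: divide_less_cancel)
  have nn: "0 \<le> ?\<tau> k" for k using t by simp
  have rv: "(\<lambda>\<omega>. W (?\<tau> k) \<omega>) \<in> borel_measurable M" for k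
    using W nn by (simp add: brownian_motion_def)
  have "indep_vars (\<lambda>_. borel) (\<lambda>k \<omega>. W (?\<tau> (Suc k)) \<omega> - W (?\<tau> k) \<omega>) {..<n}"
  proof -
    have "\<forall>(n::nat) \<tau>. 0 \<le> \<tau> 0 \<longrightarrow> (\<forall>i<n. \<tau> i \<le> \<tau> (Suc i)) \<longrightarrow>
        indep_vars (\<lambda>_. borel) (\<lambda>i \<omega>. W (\<tau> (Suc i)) \<omega> - W (\<tau> i) \<omega>) {..<n}"
      using W unfolding brownian_motion_def by (elim conjE)
    from this[THEN spec[of _ n], THEN spec[of _ ?\<tau>], THEN mp, THEN mp] mono nn[of 0]
    show ?thesis by simp
  qed
  then have "indep_vars (\<lambda>_. borel) (\<lambda>k \<omega>. c (?\<tau> (Suc k)) * (W (?\<tau> (Suc k)) \<omega> - W (?\<tau> k) \<omega>)) {..<n}"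
    by (rule indep_vars_compose2) auto
  \<comment> \<open>Frequency 1 is enough, since any other frequency can be absorbed into
    \<open>c\<close>.\<close>
  from char_distr_sum[OF this, of 1]
  have "(CLINT \<omega>|M. iexp (\<Sum>k<n. c (?\<tau> (Suc k)) * (W (?\<tau> (Suc k)) \<omega> - W (?\<tau> k) \<omega>)))
      = (\<Prod>k<n. (CLINT \<omega>|M. iexp (c (?\<tau> (Suc k)) * (W (?\<tau> (Suc k)) \<omega> - W (?\<tau> k) \<omega>))))"
    using rv by (simp add: char_def integral_distr del: of_nat_Suc)
  also have "\<dots> = (\<Prod>k<n. of_real (exp (- ((c (?\<tau> (Suc k)))\<^sup>2 * (?\<tau> (Suc k) - ?\<tau> k)) / 2)))"
    by (intro prod.cong refl brownian_increment_char[OF W nn] less) simp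
  also have "\<dots> = of_real (exp (- (\<Sum>k<n. (c (?\<tau> (Suc k)))\<^sup>2 * (?\<tau> (Suc k) - ?\<tau> k)) / 2))"
    by (simp only: sum_negf[symmetric] sum_divide_distrib exp_sum finite_lessThan of_real_prod)
  finally show ?thesis .
qed

lemma path_eval_measurable: "0 \<le> s \<Longrightarrow> (\<lambda>p. p s) \<in> borel_measurable path_space"
  unfolding path_space_def by (rule measurable_component_singleton) simp

lemma indep_var_iexp_add:
  fixes X Y :: "'a \<Rightarrow> real"
  assumes XY: "indep_var borel X borel Y"
  shows "(CLINT \<omega>|M. iexp (X \<omega> + Y \<omega>)) = (CLINT \<omega>|M. iexp (X \<omega>)) * (CLINT \<omega>|M. iexp (Y \<omega>))"
proof -
  note [measurable] = indep_var_rv1[OF XY] indep_var_rv2[OF XY]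
  show ?thesis using char_distr_add[OF XY, of 1] by (simp add: char_def integral_distr)
qed

text \<open>By independence the character factorises once the Wiener integral is replaced by the
  sums \<open>T n\<close>, where it is explicit. Since characters have modulus 1, almost sure
  convergence of \<open>T n\<close> passes to the expectations. Leaving \<open>k\<close>,
  \<open>a\<close>, \<open>b\<close> and \<open>c\<close> free covers every linear combination of
  the capital and the rate.\<close>

lemma wiener_functional_char:
  fixes c c' :: "real \<Rightarrow> real" and t :: real
  assumes W1: "brownian_motion W1" and W2: "brownian_motion W2"
    and ind12: "indep_var path_space (path W1) path_space (path W2)"
    and ind: "\<And>G. G \<in> borel_measurable (path_space \<Otimes>\<^sub>M path_space) \<Longrightarrow>
      indep_var borel \<rho> borel (\<lambda>\<omega>. G (path W1 \<omega>, path W2 \<omega>))"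
    and t: "0 < t"
    and c: "\<And>s. s \<in> {0..t} \<Longrightarrow> (c has_real_derivative c' s) (at s within {0..t})"
    and c': "continuous_on {0..t} c'"
    and S [measurable]: "S \<in> borel_measurable M"
    and S_eq: "AE \<omega> in M. S \<omega> = k + a * \<rho> \<omega>
       + (c t * W2 t \<omega> - integral {0..t} (\<lambda>s. W2 s \<omega> * c' s)) + b * W1 t \<omega>"
  shows "(CLINT \<omega>|M. iexp (S \<omega>)) = iexp k * (CLINT \<omega>|M. iexp (a * \<rho> \<omega>))
    * of_real (exp (- (integral {0..t} (\<lambda>s. (c s)\<^sup>2) + b\<^sup>2 * t) / 2))"
proof -
  have \<rho> [measurable]: "\<rho> \<in> borel_measurable M" using indep_var_rv1[OF ind[of "\<lambda>_. 0"]] by simp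
  have W1t [measurable]: "W1 t \<in> borel_measurable M" using W1 t by (auto simp: brownian_motion_def)
  have W2s: "W2 s \<in> borel_measurable M" if "0 \<le> s" for s using W2 that by (auto simp: brownian_motion_def)
  have ccont: "continuous_on {0..t} c"
    using c DERIV_continuous continuous_on_eq_continuous_within by blast
  define T where "T n \<omega> = (\<Sum>k<n. c (t * Suc k / n) * (W2 (t * Suc k / n) \<omega> - W2 (t * k / n) \<omega>))"
    for n :: nat and \<omega>
  have T [measurable]: "T n \<in> borel_measurable M" for n
    unfolding T_def[abs_def] using t by (intro borel_measurable_sum borel_measurable_times
        borel_measurable_diff W2s borel_measurable_const) auto
  \<comment> \<open>The same sum as a functional of a path: independence is given for whole paths,
    so \<open>T n\<close> must be exhibited as a measurable function of \<open>path W2\<close>. All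
    partition points are nonnegative, where \<open>path\<close> agrees with the process.\<close>
  define Tp where "Tp n p = (\<Sum>k<n. c (t * Suc k / n) * (p (t * Suc k / n) - p (t * k / n)))"
    for n :: nat and p :: "real \<Rightarrow> real"
  have [measurable]: "Tp n \<in> borel_measurable path_space" for n
    unfolding Tp_def[abs_def] using t by (intro borel_measurable_sum borel_measurable_times
        borel_measurable_diff path_eval_measurable borel_measurable_const) auto
  have [measurable]: "(\<lambda>p. p t) \<in> borel_measurable path_space"
    using t by (intro path_eval_measurable) auto
  have Tp: "Tp n (path W2 \<omega>) = T n \<omega>" for n \<omega>
    using t unfolding Tp_def T_def path_def by (intro sum.cong) auto
  have p1: "path W1 \<omega> t = W1 t \<omega>" for \<omega> using t by (simp add: path_def)
  have i1: "indep_var borel (\<lambda>\<omega>. a * \<rho> \<omega>) borel (\<lambda>\<omega>. T n \<omega> + b * W1 t \<omega>)" for n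
  proof -
    have "indep_var borel \<rho> borel (\<lambda>\<omega>. T n \<omega> + b * W1 t \<omega>)"
      using ind[of "\<lambda>x. Tp n (snd x) + b * fst x t"] by (simp add: Tp p1)
    then have "indep_var borel ((\<lambda>x. a * x) \<circ> \<rho>) borel ((\<lambda>x. x) \<circ> (\<lambda>\<omega>. T n \<omega> + b * W1 t \<omega>))"
      by (rule indep_var_compose) measurable
    then show ?thesis by (simp only: comp_def)
  qed
  have i2: "indep_var borel (\<lambda>\<omega>. b * W1 t \<omega>) borel (T n)" for n
  proof -
    have "indep_var borel ((\<lambda>p. b * p t) \<circ> path W1) borel (Tp n \<circ> path W2)"
      using ind12 by (rule indep_var_compose) measurable
    then show ?thesis by (simp only: comp_def Tp p1)
  qed
  have W1c: "(CLINT \<omega>|M. iexp (b * W1 t \<omega>)) = of_real (exp (- (b\<^sup>2 * t) / 2))"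
    by (rule brownian_char[OF W1 t])
  have "(CLINT \<omega>|M. iexp (k + a * \<rho> \<omega> + T n \<omega> + b * W1 t \<omega>))
      = iexp k * (CLINT \<omega>|M. iexp (a * \<rho> \<omega> + (T n \<omega> + b * W1 t \<omega>)))" for n
  proof -
    have "iexp (k + a * \<rho> \<omega> + T n \<omega> + b * W1 t \<omega>)
        = iexp k * iexp (a * \<rho> \<omega> + (T n \<omega> + b * W1 t \<omega>))" for \<omega>
      by (simp only: exp_add[symmetric] distrib_left[symmetric] of_real_add[symmetric] add.assoc)
    then show ?thesis by (simp only: integral_mult_right_zero)
  qed
  also have "\<dots> n = iexp k * ((CLINT \<omega>|M. iexp (a * \<rho> \<omega>)) * (CLINT \<omega>|M. iexp (b * W1 t \<omega> + T n \<omega>)))" for n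
    by (subst indep_var_iexp_add[OF i1]) (simp add: add.commute)
  also have "\<dots> n = iexp k * (CLINT \<omega>|M. iexp (a * \<rho> \<omega>)) *
      (of_real (exp (- (b\<^sup>2 * t) / 2)) *
       of_real (exp (- (\<Sum>k<n. (c (t * Suc k / n))\<^sup>2 * (t * Suc k / n - t * k / n)) / 2)))" for n
    unfolding indep_var_iexp_add[OF i2] W1c
    unfolding T_def brownian_sum_char[OF W2 t] by (simp only: mult.assoc)
  finally have char_n: "(CLINT \<omega>|M. iexp (k + a * \<rho> \<omega> + T n \<omega> + b * W1 t \<omega>)) =
      iexp k * (CLINT \<omega>|M. iexp (a * \<rho> \<omega>)) *
      (of_real (exp (- (b\<^sup>2 * t) / 2)) *
       of_real (exp (- (\<Sum>k<n. (c (t * Suc k / n))\<^sup>2 * (t * Suc k / n - t * k / n)) / 2)))" for n .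
  have lim1: "(\<lambda>n. CLINT \<omega>|M. iexp (k + a * \<rho> \<omega> + T n \<omega> + b * W1 t \<omega>)) \<longlonglongrightarrow>
      iexp k * (CLINT \<omega>|M. iexp (a * \<rho> \<omega>)) *
      (of_real (exp (- (b\<^sup>2 * t) / 2)) * of_real (exp (- integral {0..t} (\<lambda>s. (c s)\<^sup>2) / 2)))"
    unfolding char_n by (intro tendsto_intros square_riemann_sum_tendsto t ccont) simp
  \<comment> \<open>The characters are dominated by the constant 1, and the paths are almost surely
    continuous and start at 0, as summation by parts requires.\<close>
  have lim2: "(\<lambda>n. CLINT \<omega>|M. iexp (k + a * \<rho> \<omega> + T n \<omega> + b * W1 t \<omega>)) \<longlonglongrightarrow> (CLINT \<omega>|M. iexp (S \<omega>))"
  proof (rule integral_dominated_convergence[where w="\<lambda>_. 1"])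
    have "AE \<omega> in M. W2 0 \<omega> = 0" "AE \<omega> in M. continuous_on {0..} (\<lambda>t. W2 t \<omega>)"
      using W2 by (auto simp: brownian_motion_def)
    then show "AE \<omega> in M. (\<lambda>n. iexp (k + a * \<rho> \<omega> + T n \<omega> + b * W1 t \<omega>)) \<longlonglongrightarrow> iexp (S \<omega>)"
      using S_eq
    proof eventually_elim
      case (elim \<omega>)
      have "(\<lambda>n. T n \<omega>) \<longlonglongrightarrow> c t * W2 t \<omega> - integral {0..t} (\<lambda>s. W2 s \<omega> * c' s)"
        unfolding T_def
        by (rule wiener_sum_tendsto[where w="\<lambda>s. W2 s \<omega>", OF t c c' _ elim(1)])
           (auto intro: continuous_on_subset[OF elim(2)])
      then show ?case unfolding elim(3) by (intro tendsto_intros)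
    qed
  qed auto
  have "of_real (exp (- (b\<^sup>2 * t) / 2)) * of_real (exp (- integral {0..t} (\<lambda>s. (c s)\<^sup>2) / 2))
      = complex_of_real (exp (- (integral {0..t} (\<lambda>s. (c s)\<^sup>2) + b\<^sup>2 * t) / 2))"
    unfolding of_real_mult[symmetric] exp_add[symmetric] by (simp add: field_simps)
  then show ?thesis using LIMSEQ_unique[OF lim2 lim1] by simp
qed

end

section \<open>A Gaussian smoothing of the uniform distribution\<close>

lemma uniform_measure_interval_eq_density:
  fixes a b :: real
  assumes "a < b"
  shows "uniform_measure lborel {a..b} = density lborel (\<lambda>x. ennreal (indicator {a..b} x / (b - a)))"
  unfolding uniform_measure_def using assms
  by (intro arg_cong2[where f=density] refl ext) (auto simp: indicator_def divide_ennreal ennreal_1[symmetric] simp del: ennreal_1)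

lemma pair_measure_iexp_add:
  fixes X :: "'a \<Rightarrow> real" and Y :: "'b \<Rightarrow> real"
  assumes P: "prob_space P" and Q: "prob_space Q"
    and [measurable]: "X \<in> borel_measurable P" "Y \<in> borel_measurable Q"
  shows "(CLINT z|P \<Otimes>\<^sub>M Q. iexp (X (fst z) + Y (snd z))) = (CLINT x|P. iexp (X x)) * (CLINT y|Q. iexp (Y y))"
proof -
  interpret p1: prob_space P by fact
  interpret p2: prob_space Q by fact
  interpret pq: pair_prob_space P Q ..
  have "integrable (P \<Otimes>\<^sub>M Q) (\<lambda>z. iexp (X (fst z) + Y (snd z)))"
    by (rule pq.P.integrable_const_bound[where B=1]) auto
  then have "integrable (P \<Otimes>\<^sub>M Q) (\<lambda>(x, y). iexp (X x + Y y))" by (simp add: case_prod_unfold)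
  from pq.integral_fst[OF this]
  have "(CLINT z|P \<Otimes>\<^sub>M Q. iexp (X (fst z) + Y (snd z))) = (CLINT x|P. CLINT y|Q. iexp (X x + Y y))"
    by (simp add: case_prod_unfold)
  also have "\<dots> = (CLINT x|P. CLINT y|Q. iexp (X x) * iexp (Y y))"
    by (simp only: of_real_add distrib_left exp_add)
  also have "\<dots> = (CLINT x|P. iexp (X x)) * (CLINT y|Q. iexp (Y y))"
    by (simp only: integral_mult_right_zero integral_mult_left_zero)
  finally show ?thesis .
qed

text \<open>A pair (f, r) forces the noise value \<open>y = f - \<mu>0 - \<mu>1 * r\<close>; for an
  initial rate \<rho> the other noise is then forced to be
  \<open>r - K - \<tau> * y - q * \<rho>\<close>. The formula multiplies the two Gaussian densities
  at these values and averages over \<rho>. Here \<open>s\<close> and \<eta> are standard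
  deviations.\<close>

definition smoothed_uniform_density ::
    "real \<Rightarrow> real \<Rightarrow> real \<Rightarrow> real \<Rightarrow> real \<Rightarrow> real \<Rightarrow> real \<Rightarrow> real \<Rightarrow> real \<Rightarrow> real \<Rightarrow> real" where
  "smoothed_uniform_density L \<mu>0 \<mu>1 s \<eta> K q \<tau> f r =
     normal_density 0 s (f - \<mu>0 - \<mu>1 * r) / (2 * L) *
     (LINT \<rho>:{-L..L}|lborel. normal_density 0 \<eta> (r - K - \<tau> * (f - \<mu>0 - \<mu>1 * r) - q * \<rho>))"

text \<open>The rate is \<open>K + q * \<rho> + \<tau> * y + z\<close>, and the capital is expressed
  through this final rate and \<open>y\<close>. For fixed \<rho> the map from (y, z) to (f, r)
  therefore has determinant 1, even though \<open>y\<close> enters both coordinates.\<close>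

definition smoothed_uniform_law ::
    "real \<Rightarrow> real \<Rightarrow> real \<Rightarrow> real \<Rightarrow> real \<Rightarrow> real \<Rightarrow> real \<Rightarrow> real \<Rightarrow> (real \<times> real) measure" where
  "smoothed_uniform_law L \<mu>0 \<mu>1 s \<eta> K q \<tau> =
     distr (uniform_measure lborel {-L..L} \<Otimes>\<^sub>M
            (density lborel (normal_density 0 s) \<Otimes>\<^sub>M density lborel (normal_density 0 \<eta>)))
       (borel \<Otimes>\<^sub>M borel)
       (\<lambda>(\<rho>, y, z). (\<mu>0 + \<mu>1 * (K + q * \<rho> + \<tau> * y + z) + y, K + q * \<rho> + \<tau> * y + z))"

lemma continuous_normal_density [continuous_intros]:
  "0 < \<sigma> \<Longrightarrow> continuous_on S f \<Longrightarrow> continuous_on S (\<lambda>x. normal_density \<mu> \<sigma> (f x))"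
  unfolding normal_density_def by (intro continuous_intros) auto

lemma smoothed_uniform_density_nonneg: "0 < L \<Longrightarrow> 0 \<le> smoothed_uniform_density L \<mu>0 \<mu>1 s \<eta> K q \<tau> f r"
  unfolding smoothed_uniform_density_def set_lebesgue_integral_def
  by (intro mult_nonneg_nonneg divide_nonneg_nonneg integral_nonneg_AE) auto

lemma set_integrable_normal_kernel:
  "0 < \<eta> \<Longrightarrow> set_integrable lborel {a..b} (\<lambda>\<rho>. normal_density 0 \<eta> (d - q * \<rho>))"
  by (intro borel_integrable_atLeastAtMost' continuous_intros)

text \<open>The average over \<rho> is an integral of a jointly continuous kernel over a compact
  interval, so continuity in the parameters is inherited. \<open>joint_density\<close> selects the
  continuous version of the density.\<close>

lemma continuous_smoothed_uniform_density:
  assumes "0 < s" "0 < \<eta>" "0 < L"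
  shows "continuous_on UNIV (\<lambda>(f, r). smoothed_uniform_density L \<mu>0 \<mu>1 s \<eta> K q \<tau> f r)"
proof -
  have "continuous_on UNIV (\<lambda>p::real \<times> real. integral (cbox (-L) L)
      (\<lambda>\<rho>. normal_density 0 \<eta> (snd p - K - \<tau> * (fst p - \<mu>0 - \<mu>1 * snd p) - q * \<rho>)))"
    by (rule integral_continuous_on_param)
       (auto simp: case_prod_unfold intro!: continuous_intros assms)
  then have "continuous_on UNIV (\<lambda>p::real \<times> real. normal_density 0 s (fst p - \<mu>0 - \<mu>1 * snd p) / (2 * L) *
      integral {-L..L} (\<lambda>\<rho>. normal_density 0 \<eta> (snd p - K - \<tau> * (fst p - \<mu>0 - \<mu>1 * snd p) - q * \<rho>)))"
    using assms by (auto intro!: continuous_intros)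
  then show ?thesis
    using assms by (simp add: smoothed_uniform_density_def case_prod_unfold
        set_borel_integral_eq_integral(2)[OF set_integrable_normal_kernel])
qed

text \<open>The planar change of variables is split into two translations of the line,
  \<open>z\<close> to \<open>r\<close> for fixed (\<rho>, y) and then \<open>y\<close> to
  \<open>f\<close> for fixed (\<rho>, r), with Tonelli exchanging the order of integration. Each
  translation preserves Lebesgue measure, so no Jacobian appears.\<close>

lemma smoothed_uniform_law_eq_density:
  assumes s: "0 < s" and \<eta>: "0 < \<eta>" and L: "0 < L"
  shows "smoothed_uniform_law L \<mu>0 \<mu>1 s \<eta> K q \<tau>
    = density (lborel \<Otimes>\<^sub>M lborel) (\<lambda>(f, r). ennreal (smoothed_uniform_density L \<mu>0 \<mu>1 s \<eta> K q \<tau> f r))"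
    (is "?T = density _ ?d")
proof (rule measure_eqI)
  show "sets ?T = sets (density (lborel \<Otimes>\<^sub>M lborel) ?d)"
    by (simp add: smoothed_uniform_law_def cong: sets_pair_measure_cong)
  fix A assume "A \<in> sets ?T"
  then have A [measurable]: "A \<in> sets (borel \<Otimes>\<^sub>M borel)" by (simp add: smoothed_uniform_law_def)
  define u where "u \<rho> = (indicator {-L..L} \<rho> / (2 * L) :: real)" for \<rho>
  have [measurable]: "u \<in> borel_measurable borel" unfolding u_def[abs_def] by measurable
  have u0: "0 \<le> u \<rho>" for \<rho> using L by (simp add: u_def)
  have U: "uniform_measure lborel {-L..L} = density lborel (\<lambda>x. ennreal (u x))"
    using uniform_measure_interval_eq_density[of "-L" L] L by (simp add: u_def[abs_def])
  have [measurable]: "?d \<in> borel_measurable (lborel \<Otimes>\<^sub>M lborel)"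
  proof -
    have "(\<lambda>(f, r). smoothed_uniform_density L \<mu>0 \<mu>1 s \<eta> K q \<tau> f r) \<in> borel_measurable borel"
      by (intro borel_measurable_continuous_onI continuous_smoothed_uniform_density assms)
    then show ?thesis unfolding lborel_prod by (simp add: case_prod_unfold)
  qed
  let ?Ns = "density lborel (normal_density 0 s)" and ?N\<eta> = "density lborel (normal_density 0 \<eta>)"
  interpret U: prob_space "uniform_measure lborel {-L..L}"
    using L by (intro prob_space_uniform_measure) auto
  interpret Ns: prob_space ?Ns using s by (rule prob_space_normal_density)
  interpret N\<eta>: prob_space ?N\<eta> using \<eta> by (rule prob_space_normal_density)
  interpret NN: pair_prob_space ?Ns ?N\<eta> ..
  \<comment> \<open>The complete integrand in the mixed variables (\<rho>, y, r), halfway between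
    the noises and the target coordinates.\<close>
  define H where "H \<rho> y r = ennreal (u \<rho> * normal_density 0 s y * normal_density 0 \<eta> (r - K - \<tau> * y - q * \<rho>)) *
      indicator A (\<mu>0 + \<mu>1 * r + y, r)" for \<rho> y r
  have H [measurable]: "(\<lambda>x. H (a x) (b x) (c x)) \<in> borel_measurable M"
    if [measurable]: "a \<in> borel_measurable M" "b \<in> borel_measurable M" "c \<in> borel_measurable M" for a b c M
    unfolding H_def by measurable
  have "emeasure ?T A = (\<integral>\<^sup>+ x. indicator A x \<partial>?T)"
    using \<open>A \<in> sets ?T\<close> by simp
  also have "\<dots> = (\<integral>\<^sup>+ x. indicator A (case x of (\<rho>, y, z) \<Rightarrow>
      (\<mu>0 + \<mu>1 * (K + q * \<rho> + \<tau> * y + z) + y, K + q * \<rho> + \<tau> * y + z))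
      \<partial>(uniform_measure lborel {-L..L} \<Otimes>\<^sub>M (?Ns \<Otimes>\<^sub>M ?N\<eta>)))"
    unfolding smoothed_uniform_law_def by (subst nn_integral_distr) auto
  also have "\<dots> = (\<integral>\<^sup>+ \<rho>. \<integral>\<^sup>+ y. \<integral>\<^sup>+ z.
      indicator A (\<mu>0 + \<mu>1 * (K + q * \<rho> + \<tau> * y + z) + y, K + q * \<rho> + \<tau> * y + z)
      \<partial>?N\<eta> \<partial>?Ns \<partial>uniform_measure lborel {-L..L})"
    by (subst NN.nn_integral_fst[symmetric], measurable)
       (auto intro!: nn_integral_cong simp: N\<eta>.nn_integral_fst[symmetric])
  also have "\<dots> = (\<integral>\<^sup>+ \<rho>. \<integral>\<^sup>+ y. \<integral>\<^sup>+ z. H \<rho> y (K + q * \<rho> + \<tau> * y + z) \<partial>lborel \<partial>lborel \<partial>lborel)"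
    unfolding U
    by (simp add: nn_integral_density H_def u0 ennreal_mult mult.assoc nn_integral_cmult[symmetric])
  also have "\<dots> = (\<integral>\<^sup>+ \<rho>. \<integral>\<^sup>+ y. \<integral>\<^sup>+ r. H \<rho> y r \<partial>lborel \<partial>lborel \<partial>lborel)"
  proof -
    have "(\<integral>\<^sup>+ r. H \<rho> y r \<partial>lborel) = (\<integral>\<^sup>+ z. H \<rho> y (K + q * \<rho> + \<tau> * y + z) \<partial>lborel)" for \<rho> y
      using nn_integral_real_affine[of "H \<rho> y" 1 "K + q * \<rho> + \<tau> * y"] by simp
    then show ?thesis by (simp only:)
  qed
  \<comment> \<open>The shift from \<open>y\<close> to \<open>f\<close> depends on \<open>r\<close>,
    so \<open>r\<close> has to be outside the integral over \<open>y\<close>.\<close>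
  also have "\<dots> = (\<integral>\<^sup>+ \<rho>. \<integral>\<^sup>+ r. \<integral>\<^sup>+ y. H \<rho> y r \<partial>lborel \<partial>lborel \<partial>lborel)"
    by (intro nn_integral_cong lborel_pair.Fubini') simp
  also have "\<dots> = (\<integral>\<^sup>+ \<rho>. \<integral>\<^sup>+ r. \<integral>\<^sup>+ f. H \<rho> (f - \<mu>0 - \<mu>1 * r) r \<partial>lborel \<partial>lborel \<partial>lborel)"
  proof -
    have "(\<integral>\<^sup>+ y. H \<rho> y r \<partial>lborel) = (\<integral>\<^sup>+ f. H \<rho> (f - \<mu>0 - \<mu>1 * r) r \<partial>lborel)" for \<rho> r
      using nn_integral_real_affine[of "\<lambda>y. H \<rho> y r" 1 "- \<mu>0 - \<mu>1 * r"] by (simp add: algebra_simps)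
    then show ?thesis by (simp only:)
  qed
  also have "\<dots> = (\<integral>\<^sup>+ \<rho>. \<integral>\<^sup>+ f. \<integral>\<^sup>+ r. H \<rho> (f - \<mu>0 - \<mu>1 * r) r \<partial>lborel \<partial>lborel \<partial>lborel)"
    by (intro nn_integral_cong lborel_pair.Fubini') simp
  also have "\<dots> = (\<integral>\<^sup>+ f. \<integral>\<^sup>+ \<rho>. \<integral>\<^sup>+ r. H \<rho> (f - \<mu>0 - \<mu>1 * r) r \<partial>lborel \<partial>lborel \<partial>lborel)"
    by (intro lborel_pair.Fubini') simp
  also have "\<dots> = (\<integral>\<^sup>+ f. \<integral>\<^sup>+ r. \<integral>\<^sup>+ \<rho>. H \<rho> (f - \<mu>0 - \<mu>1 * r) r \<partial>lborel \<partial>lborel \<partial>lborel)"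
    by (intro nn_integral_cong lborel_pair.Fubini') simp
  also have "\<dots> = (\<integral>\<^sup>+ f. \<integral>\<^sup>+ r. ?d (f, r) * indicator A (f, r) \<partial>lborel \<partial>lborel)"
  proof (intro nn_integral_cong)
    fix f r :: real
    let ?k = "\<lambda>\<rho>. normal_density 0 \<eta> (r - K - \<tau> * (f - \<mu>0 - \<mu>1 * r) - q * \<rho>)"
    have "(\<integral>\<^sup>+ \<rho>. H \<rho> (f - \<mu>0 - \<mu>1 * r) r \<partial>lborel) =
        (\<integral>\<^sup>+ \<rho>. (ennreal (normal_density 0 s (f - \<mu>0 - \<mu>1 * r) / (2 * L)) * indicator A (f, r)) *
          ennreal (indicator {-L..L} \<rho> *\<^sub>R ?k \<rho>) \<partial>lborel)"
      using L by (intro nn_integral_cong)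
        (auto simp: H_def u_def indicator_def ennreal_mult[symmetric] mult_ac)
    also have "\<dots> = (ennreal (normal_density 0 s (f - \<mu>0 - \<mu>1 * r) / (2 * L)) * indicator A (f, r)) *
        (\<integral>\<^sup>+ \<rho>. ennreal (indicator {-L..L} \<rho> *\<^sub>R ?k \<rho>) \<partial>lborel)"
      by (rule nn_integral_cmult) simp
    also have "(\<integral>\<^sup>+ \<rho>. ennreal (indicator {-L..L} \<rho> *\<^sub>R ?k \<rho>) \<partial>lborel) = ennreal (LINT \<rho>:{-L..L}|lborel. ?k \<rho>)"
      unfolding set_lebesgue_integral_def
      using set_integrable_normal_kernel[OF \<eta>, of "-L" L] 
      by (intro nn_integral_eq_integral) (auto simp: set_integrable_def)
    finally show "(\<integral>\<^sup>+ \<rho>. H \<rho> (f - \<mu>0 - \<mu>1 * r) r \<partial>lborel) = ?d (f, r) * indicator A (f, r)"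
      using L unfolding smoothed_uniform_density_def prod.case
      by (subst ennreal_mult') (auto simp: mult_ac)
  qed
  also have "\<dots> = (\<integral>\<^sup>+ x. ?d x * indicator A x \<partial>(lborel \<Otimes>\<^sub>M lborel))"
    by (rule lborel.nn_integral_fst) measurable
  also have "\<dots> = emeasure (density (lborel \<Otimes>\<^sub>M lborel) ?d) A"
    by (rule emeasure_density[symmetric]) measurable
  finally show "emeasure ?T A = emeasure (density (lborel \<Otimes>\<^sub>M lborel) ?d) A" .
qed

lemma smoothed_uniform_law_char:
  assumes s: "0 < s" and \<eta>: "0 < \<eta>" and L: "0 < L"
  shows "(CLINT x|smoothed_uniform_law L \<mu>0 \<mu>1 s \<eta> K q \<tau>. iexp (u * fst x + v * snd x)) =
    iexp (u * \<mu>0 + (u * \<mu>1 + v) * K) *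
    (CLINT \<rho>|uniform_measure lborel {-L..L}. iexp ((u * \<mu>1 + v) * q * \<rho>)) *
    of_real (exp (- (((u * \<mu>1 + v) * \<tau> + u)\<^sup>2 * s\<^sup>2 + (u * \<mu>1 + v)\<^sup>2 * \<eta>\<^sup>2) / 2))"
proof -
  let ?U = "uniform_measure lborel {-L..L}"
  let ?Ns = "density lborel (normal_density 0 s)" and ?N\<eta> = "density lborel (normal_density 0 \<eta>)"
  interpret U: prob_space ?U using L by (intro prob_space_uniform_measure) auto
  interpret Ns: prob_space ?Ns using s by (rule prob_space_normal_density)
  interpret N\<eta>: prob_space ?N\<eta> using \<eta> by (rule prob_space_normal_density)
  interpret NN: pair_prob_space ?Ns ?N\<eta> ..
  \<comment> \<open>Since \<open>f = \<mu>0 + \<mu>1 * r + y\<close>, the rate enters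
    \<open>u * f + v * r\<close> with total coefficient \<open>w\<close>; the exponent then
    separates into three independent variables.\<close>
  define w where "w = u * \<mu>1 + v"
  have char_s: "(CLINT y|?Ns. iexp (a * y)) = of_real (exp (- (a\<^sup>2 * s\<^sup>2) / 2))" for a
    using Ns.normal_distributed_char[of "\<lambda>x. x" s a] s by (simp add: distributed_def distr_id2)
  have char_\<eta>: "(CLINT y|?N\<eta>. iexp (a * y)) = of_real (exp (- (a\<^sup>2 * \<eta>\<^sup>2) / 2))" for a
    using N\<eta>.normal_distributed_char[of "\<lambda>x. x" \<eta> a] \<eta> by (simp add: distributed_def distr_id2)
  have "(CLINT x|smoothed_uniform_law L \<mu>0 \<mu>1 s \<eta> K q \<tau>. iexp (u * fst x + v * snd x)) =
      (CLINT x|?U \<Otimes>\<^sub>M (?Ns \<Otimes>\<^sub>M ?N\<eta>). iexp (u * (\<mu>0 + \<mu>1 * (K + q * fst x + \<tau> * fst (snd x) + snd (snd x)) + fst (snd x))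
        + v * (K + q * fst x + \<tau> * fst (snd x) + snd (snd x))))"
    unfolding smoothed_uniform_law_def by (subst integral_distr) (auto simp: case_prod_unfold)
  also have "\<dots> = (CLINT x|?U \<Otimes>\<^sub>M (?Ns \<Otimes>\<^sub>M ?N\<eta>). iexp (u * \<mu>0 + w * K) *
      iexp (w * q * fst x + ((w * \<tau> + u) * fst (snd x) + w * snd (snd x))))"
    unfolding exp_add[symmetric] distrib_left[symmetric] of_real_add[symmetric]
    by (simp add: w_def algebra_simps)
  also have "\<dots> = iexp (u * \<mu>0 + w * K) * (CLINT x|?U \<Otimes>\<^sub>M (?Ns \<Otimes>\<^sub>M ?N\<eta>).
      iexp (w * q * fst x + ((w * \<tau> + u) * fst (snd x) + w * snd (snd x))))"
    by (rule integral_mult_right_zero)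
  also have "(CLINT x|?U \<Otimes>\<^sub>M (?Ns \<Otimes>\<^sub>M ?N\<eta>).
      iexp (w * q * fst x + ((w * \<tau> + u) * fst (snd x) + w * snd (snd x))))
    = (CLINT \<rho>|?U. iexp (w * q * \<rho>)) * (CLINT x|?Ns \<Otimes>\<^sub>M ?N\<eta>. iexp ((w * \<tau> + u) * fst x + w * snd x))"
    by (rule pair_measure_iexp_add[where X="\<lambda>\<rho>. w * q * \<rho>" and Y="\<lambda>x. (w * \<tau> + u) * fst x + w * snd x",
          OF U.prob_space_axioms NN.P.prob_space_axioms]) measurable
  also have "(CLINT x|?Ns \<Otimes>\<^sub>M ?N\<eta>. iexp ((w * \<tau> + u) * fst x + w * snd x)) =
      (CLINT y|?Ns. iexp ((w * \<tau> + u) * y)) * (CLINT z|?N\<eta>. iexp (w * z))"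
    by (rule pair_measure_iexp_add[where X="\<lambda>y. (w * \<tau> + u) * y" and Y="\<lambda>z. w * z",
          OF Ns.prob_space_axioms N\<eta>.prob_space_axioms]) measurable
  also have "\<dots> = of_real (exp (- ((w * \<tau> + u)\<^sup>2 * s\<^sup>2 + w\<^sup>2 * \<eta>\<^sup>2) / 2))"
    unfolding char_s char_\<eta> of_real_mult[symmetric] exp_add[symmetric] by (simp add: add_divide_distrib)
  finally show ?thesis unfolding w_def by (simp only: mult.assoc)
qed

section \<open>Limits of the truncated moments\<close>

text \<open>The set where two continuous functions differ is open, and a nonempty open set is never
  Lebesgue null.\<close>

lemma continuous_AE_eq_imp_eq:
  fixes f g :: "'a::euclidean_space \<Rightarrow> 'b::t2_space"
  assumes f: "continuous_on UNIV f" and g: "continuous_on UNIV g" and eq: "AE x in lborel. f x = g x"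
  shows "f = g"
proof (rule ccontr)
  assume "f \<noteq> g"
  then have "{x. f x \<noteq> g x} \<noteq> {}" by auto
  moreover have "open {x. f x \<noteq> g x}" using f g by (rule open_Collect_neq)
  ultimately have "\<not> negligible {x. f x \<noteq> g x}" by (intro open_not_negligible)
  moreover have "AE x in lebesgue. f x = g x" using eq by (rule AE_completion)
  then have "{x \<in> space lebesgue. \<not> f x = g x} \<in> null_sets lebesgue"
    using \<open>open {x. f x \<noteq> g x}\<close> by (intro AE_iff_null[THEN iffD1]) (auto intro: lborelD borel_open)
  ultimately show False by (simp add: negligible_iff_null_sets)
qed

text \<open>Any two densities of the same law agree almost everywhere, and continuity upgrades this
  to equality everywhere, so the definite description evaluates to \<open>p\<close>.\<close>

lemma (in prob_space) joint_density_eqI: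
  assumes p: "continuous_on UNIV (\<lambda>(x, y). p x y)" "\<And>x y. 0 \<le> p x y"
    and d: "distributed M (lborel \<Otimes>\<^sub>M lborel) (\<lambda>\<omega>. (X \<omega>, Y \<omega>)) (\<lambda>(x, y). ennreal (p x y))"
  shows "joint_density M X Y = p"
  unfolding joint_density_def
proof (rule the_equality)
  fix p' assume p': "continuous_on UNIV (\<lambda>(x, y). p' x y) \<and> (\<forall>x y. 0 \<le> p' x y) \<and>
     distributed M (lborel \<Otimes>\<^sub>M lborel) (\<lambda>\<omega>. (X \<omega>, Y \<omega>)) (\<lambda>(x, y). ennreal (p' x y))"
  then have "AE z in lborel \<Otimes>\<^sub>M lborel. (case z of (x, y) \<Rightarrow> ennreal (p' x y)) = (case z of (x, y) \<Rightarrow> ennreal (p x y))"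
    using d by (intro distributed_unique) auto
  then have "AE z in lborel. (\<lambda>(x, y). p' x y) z = (\<lambda>(x, y). p x y) z"
    unfolding lborel_prod
  proof eventually_elim
    case (elim z)
    then show ?case using p' p(2) by (cases z) auto
  qed
  then have "(\<lambda>(x, y). p' x y) = (\<lambda>(x, y). p x y)"
    using p' p(1) by (intro continuous_AE_eq_imp_eq) auto
  then show "p' = p" by (auto simp: fun_eq_iff)
qed (use assms in auto)

lemma has_bochner_integral_normal_kernel:
  assumes "0 < \<eta>" "0 < q"
  shows "has_bochner_integral lborel (\<lambda>\<rho>. normal_density 0 \<eta> (d - q * \<rho>)) (1 / q)"
proof -
  have "has_bochner_integral lborel (normal_density 0 \<eta>) 1"
    using assms by (simp add: has_bochner_integral_iff)
  then show ?thesis using assms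
    using lborel_has_bochner_integral_real_affine_iff[of "- q" "normal_density 0 \<eta>" 1 d]
    by (simp add: inverse_eq_divide)
qed

text \<open>Over the whole line the kernel integrates to \<open>1 / q\<close> by substitution,
  whatever \<open>d\<close> is. The truncated integrals therefore stay below a bound independent of
  \<open>d\<close> and \<open>L\<close>, which later provides the dominating function.\<close>

lemma truncated_normal_kernel:
  assumes "0 < \<eta>" "0 < q"
  shows truncated_normal_kernel_bounds:
      "0 \<le> (LINT \<rho>:{-L..L}|lborel. normal_density 0 \<eta> (d - q * \<rho>))"
      "(LINT \<rho>:{-L..L}|lborel. normal_density 0 \<eta> (d - q * \<rho>)) \<le> 1 / q"
    and truncated_normal_kernel_tendsto:
      "((\<lambda>L. LINT \<rho>:{-L..L}|lborel. normal_density 0 \<eta> (d - q * \<rho>)) \<longlongrightarrow> 1 / q) at_top"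
proof -
  let ?k = "\<lambda>\<rho>. normal_density 0 \<eta> (d - q * \<rho>)"
  have int: "integrable lborel ?k" and val: "integral\<^sup>L lborel ?k = 1 / q"
    using has_bochner_integral_normal_kernel[OF assms, of d] by (auto simp: has_bochner_integral_iff)
  show "0 \<le> (LINT \<rho>:{-L..L}|lborel. ?k \<rho>)"
    unfolding set_lebesgue_integral_def by (intro integral_nonneg_AE) auto
  show "(LINT \<rho>:{-L..L}|lborel. ?k \<rho>) \<le> 1 / q"
    unfolding set_lebesgue_integral_def val[symmetric]
    by (intro integral_mono int integrable_mult_indicator) (auto simp: indicator_def)
  have "((\<lambda>L. LINT \<rho>:{-L..L}|lborel. ?k \<rho>) \<longlongrightarrow> integral\<^sup>L lborel ?k) at_top"
    unfolding set_lebesgue_integral_def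
  proof (rule integral_dominated_convergence_at_top[where w="?k"])
    show "AE x in lborel. ((\<lambda>L. indicator {-L..L} x *\<^sub>R ?k x) \<longlongrightarrow> ?k x) at_top"
    proof (intro AE_I2 tendsto_eventually)
      fix x :: real
      show "\<forall>\<^sub>F L in at_top. indicator {-L..L} x *\<^sub>R ?k x = ?k x"
        using eventually_ge_at_top[of "\<bar>x\<bar>"] by eventually_elim (auto simp: indicator_def)
    qed
  qed (auto simp: int indicator_def)
  then show "((\<lambda>L. LINT \<rho>:{-L..L}|lborel. ?k \<rho>) \<longlongrightarrow> 1 / q) at_top" by (simp only: val)
qed

section \<open>Normal moments as limits of truncated integrals\<close>

lemma normal_raw_moments:
  assumes "0 < s"
  shows "has_bochner_integral lborel (\<lambda>f. f ^ 0 * normal_density 0 s (f - m)) 1"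
    and "has_bochner_integral lborel (\<lambda>f. f ^ 1 * normal_density 0 s (f - m)) m"
    and "has_bochner_integral lborel (\<lambda>f. f ^ 2 * normal_density 0 s (f - m)) (s\<^sup>2 + m\<^sup>2)"
proof -
  have eq: "normal_density 0 s (f - m) = normal_density m s f" for f by (simp add: normal_density_def)
  have 0: "has_bochner_integral lborel (normal_density m s) 1"
    using assms by (simp add: has_bochner_integral_iff)
  have 1: "has_bochner_integral lborel (\<lambda>f. normal_density m s f * f) m"
    by (rule normal_moment_nz_1[OF assms])
  have 2: "has_bochner_integral lborel (\<lambda>f. normal_density m s f * (f - m)\<^sup>2) (s\<^sup>2)"
    using normal_moment_even[OF assms, of m 1] by (simp add: power2_eq_square)
  show "has_bochner_integral lborel (\<lambda>f. f ^ 0 * normal_density 0 s (f - m)) 1"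
    using 0 by (simp add: eq)
  show "has_bochner_integral lborel (\<lambda>f. f ^ 1 * normal_density 0 s (f - m)) m"
    using 1 by (simp add: eq mult.commute)
  \<comment> \<open>Expansion of the raw square as
    \<open>f\<^sup>2 = (f - m)\<^sup>2 + 2 * m * f - m\<^sup>2\<close>.\<close>
  have "has_bochner_integral lborel (\<lambda>f. normal_density m s f * (f - m)\<^sup>2 + (2 * m) * (normal_density m s f * f)
      - m\<^sup>2 * normal_density m s f) (s\<^sup>2 + (2 * m) * m - m\<^sup>2 * 1)"
    by (intro has_bochner_integral_add has_bochner_integral_diff has_bochner_integral_mult_right 0 1 2)
  then show "has_bochner_integral lborel (\<lambda>f. f ^ 2 * normal_density 0 s (f - m)) (s\<^sup>2 + m\<^sup>2)"
    by (simp add: eq power2_eq_square algebra_simps)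
qed

text \<open>The factor \<open>2 * L\<close> undoes the vanishing height of the uniform density. The
  truncations of \<open>f\<close> and of the initial rate grow together, but a single dominated
  convergence handles both, because the inner integral is at most \<open>1 / q\<close> uniformly in
  \<open>f\<close> and \<open>L\<close>.\<close>

lemma truncated_moment_tendsto:
  assumes s: "0 < s" and \<eta>: "0 < \<eta>" and q: "0 < q"
    and moment: "has_bochner_integral lborel (\<lambda>f. f ^ k * normal_density 0 s (f - \<mu>0 - \<mu>1 * r)) m"
  shows "((\<lambda>L. 2 * L * (LINT f:{-L..L}|lborel. f ^ k * smoothed_uniform_density L \<mu>0 \<mu>1 s \<eta> K q \<tau> f r))
    \<longlongrightarrow> m / q) at_top"
proof -
  let ?n = "\<lambda>f. f ^ k * normal_density 0 s (f - \<mu>0 - \<mu>1 * r)"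
  define I where "I L f = (LINT \<rho>:{-L..L}|lborel. normal_density 0 \<eta> (r - K - \<tau> * (f - \<mu>0 - \<mu>1 * r) - q * \<rho>))" for L f
  have I [measurable]: "I L \<in> borel_measurable borel" for L
    unfolding I_def[abs_def] set_lebesgue_integral_def by measurable
  have I_bound: "0 \<le> I L f" "I L f \<le> 1 / q" for L f
    unfolding I_def by (intro truncated_normal_kernel_bounds \<eta> q)+
  have int: "integrable lborel ?n" and val: "integral\<^sup>L lborel ?n = m"
    using moment by (auto simp: has_bochner_integral_iff)
  have "((\<lambda>L. LINT f|lborel. indicator {-L..L} f *\<^sub>R (?n f * I L f)) \<longlongrightarrow> (LINT f|lborel. ?n f * (1 / q))) at_top"
  proof (rule integral_dominated_convergence_at_top[where w="\<lambda>f. \<bar>?n f\<bar> * (1 / q)"])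
    show "integrable lborel (\<lambda>f. \<bar>?n f\<bar> * (1 / q))" using int by simp
    show "AE f in lborel. ((\<lambda>L. indicator {-L..L} f *\<^sub>R (?n f * I L f)) \<longlongrightarrow> ?n f * (1 / q)) at_top"
    proof (rule AE_I2)
      fix f :: real
      have "((\<lambda>L. ?n f * I L f) \<longlongrightarrow> ?n f * (1 / q)) at_top"
        unfolding I_def by (intro tendsto_mult tendsto_const truncated_normal_kernel_tendsto \<eta> q)
      moreover have "\<forall>\<^sub>F L in at_top. ?n f * I L f = indicator {-L..L} f *\<^sub>R (?n f * I L f)"
        using eventually_ge_at_top[of "\<bar>f\<bar>"] by eventually_elim (auto simp: indicator_def)
      ultimately show "((\<lambda>L. indicator {-L..L} f *\<^sub>R (?n f * I L f)) \<longlongrightarrow> ?n f * (1 / q)) at_top"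
        by (rule Lim_transform_eventually)
    qed
    show "\<forall>\<^sub>F L in at_top. AE f in lborel. norm (indicator {-L..L} f *\<^sub>R (?n f * I L f)) \<le> \<bar>?n f\<bar> * (1 / q)"
    proof (intro always_eventually allI AE_I2)
      fix L f
      have "\<bar>?n f * I L f\<bar> \<le> \<bar>?n f\<bar> * (1 / q)"
        unfolding abs_mult[of "?n f"] using I_bound[of L f] by (intro mult_left_mono) auto
      then show "norm (indicator {-L..L} f *\<^sub>R (?n f * I L f)) \<le> \<bar>?n f\<bar> * (1 / q)"
        using q by (simp add: indicator_def)
    qed
  qed auto
  then have "((\<lambda>L. LINT f|lborel. indicator {-L..L} f *\<^sub>R (?n f * I L f)) \<longlongrightarrow> m / q) at_top"
    unfolding integral_mult_left_zero val by simp
  moreover have "\<forall>\<^sub>F L in at_top. (LINT f|lborel. indicator {-L..L} f *\<^sub>R (?n f * I L f)) =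
      2 * L * (LINT f:{-L..L}|lborel. f ^ k * smoothed_uniform_density L \<mu>0 \<mu>1 s \<eta> K q \<tau> f r)"
    using eventually_gt_at_top[of 0]
  proof eventually_elim
    case (elim L)
    then show ?case
      unfolding set_lebesgue_integral_def integral_mult_right_zero[symmetric]
      by (intro Bochner_Integration.integral_cong) (auto simp: smoothed_uniform_density_def I_def)
  qed
  ultimately show ?thesis by (rule Lim_transform_eventually)
qed

section \<open>The Vasicek model\<close>

lemma integral_square_pos:
  fixes g :: "real \<Rightarrow> real"
  assumes "0 < t" and g: "continuous_on {0..t} g" and "x \<in> {0..t}" "g x \<noteq> 0"
  shows "0 < integral {0..t} (\<lambda>s. (g s)\<^sup>2)"
proof -
  have "integral {0..t} (\<lambda>s. (g s)\<^sup>2) \<noteq> 0"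
    using assms integral_eq_0_iff[of 0 t "\<lambda>s. (g s)\<^sup>2"] continuous_on_power[OF g, of 2] by auto
  moreover have "0 \<le> integral {0..t} (\<lambda>s. (g s)\<^sup>2)"
    by (intro Henstock_Kurzweil_Integration.integral_nonneg integrable_continuous_interval continuous_intros g) auto
  ultimately show ?thesis by simp
qed

lemma integral_square_linear_combination:
  fixes f g :: "real \<Rightarrow> real"
  assumes f: "continuous_on {a..b} f" and g: "continuous_on {a..b} g"
  shows "integral {a..b} (\<lambda>s. (x * f s + y * g s)\<^sup>2) = x\<^sup>2 * integral {a..b} (\<lambda>s. (f s)\<^sup>2)
    + 2 * x * y * integral {a..b} (\<lambda>s. f s * g s) + y\<^sup>2 * integral {a..b} (\<lambda>s. (g s)\<^sup>2)"
proof -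
  have "integral {a..b} (\<lambda>s. (x * f s + y * g s)\<^sup>2) =
      integral {a..b} (\<lambda>s. x\<^sup>2 * (f s)\<^sup>2 + 2 * x * y * (f s * g s) + y\<^sup>2 * (g s)\<^sup>2)"
    by (intro Henstock_Kurzweil_Integration.integral_cong) (simp add: power2_eq_square algebra_simps)
  also have "\<dots> = integral {a..b} (\<lambda>s. x\<^sup>2 * (f s)\<^sup>2) + integral {a..b} (\<lambda>s. 2 * x * y * (f s * g s))
      + integral {a..b} (\<lambda>s. y\<^sup>2 * (g s)\<^sup>2)"
    by (subst Henstock_Kurzweil_Integration.integral_add;
        (subst Henstock_Kurzweil_Integration.integral_add)?;
        (intro integrable_continuous_interval continuous_intros f g | simp))
  finally show ?thesis by simp
qed

text \<open>The origin of \<phi>: up to the factor \<open>- 1 / (2 * \<beta>)\<close> it is the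
  squared norm of the integrand that remains after solving the rate equation backwards.\<close>

lemma integral_exp_minus_one_square:
  fixes \<beta> t :: real
  assumes "\<beta> \<noteq> 0" "0 \<le> t"
  shows "integral {0..t} (\<lambda>s. (exp (- \<beta> * s) - 1)\<^sup>2)
    = - (exp (- 2 * \<beta> * t) - 4 * exp (- \<beta> * t) - 2 * \<beta> * t + 3) / (2 * \<beta>)"
proof -
  define G where "G s = - exp (- 2 * \<beta> * s) / (2 * \<beta>) + 2 * exp (- \<beta> * s) / \<beta> + s" for s
  have "((\<lambda>s. (exp (- \<beta> * s) - 1)\<^sup>2) has_integral G t - G 0) {0..t}"
  proof (rule fundamental_theorem_of_calculus[OF \<open>0 \<le> t\<close>])
    fix s
    have "(G has_real_derivative exp (- 2 * \<beta> * s) - 2 * exp (- \<beta> * s) + 1) (at s within {0..t})"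
      unfolding G_def[abs_def] using \<open>\<beta> \<noteq> 0\<close> by (auto intro!: derivative_eq_intros)
    moreover have "exp (- 2 * \<beta> * s) - 2 * exp (- \<beta> * s) + 1 = (exp (- \<beta> * s) - 1)\<^sup>2"
      by (simp add: power2_eq_square algebra_simps exp_add[symmetric])
    ultimately show "(G has_vector_derivative (exp (- \<beta> * s) - 1)\<^sup>2) (at s within {0..t})"
      by (simp add: has_real_derivative_iff_has_vector_derivative)
  qed
  then have "integral {0..t} (\<lambda>s. (exp (- \<beta> * s) - 1)\<^sup>2) = G t - G 0" by (rule integral_unique)
  also have "\<dots> = - (exp (- 2 * \<beta> * t) - 4 * exp (- \<beta> * t) - 2 * \<beta> * t + 3) / (2 * \<beta>)"
    using \<open>\<beta> \<noteq> 0\<close> by (simp add: G_def field_simps)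
  finally show ?thesis .
qed

text \<open>Completing the square leaves a maximal value minus \<open>a\<close> times a square,
  which vanishes at one point only. The equivalence yields both existence and uniqueness of the
  maximiser.\<close>

lemma concave_quadratic_unique_max:
  fixes a b c :: real
  assumes "0 < a"
  shows "(\<forall>x. - a * x\<^sup>2 + b * x + c \<le> - a * y\<^sup>2 + b * y + c) \<longleftrightarrow> y = b / (2 * a)"
proof -
  have sq: "- a * x\<^sup>2 + b * x + c = c + b\<^sup>2 / (4 * a) - a * (x - b / (2 * a))\<^sup>2" for x
    using assms by (simp add: field_simps power2_eq_square)
  show ?thesis
  proof
    assume "\<forall>x. - a * x\<^sup>2 + b * x + c \<le> - a * y\<^sup>2 + b * y + c"
    from this[THEN spec[of _ "b / (2 * a)"]] have "a * (y - b / (2 * a))\<^sup>2 \<le> 0" unfolding sq by simp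
    then have "(y - b / (2 * a))\<^sup>2 \<le> 0" using assms by (simp add: mult_le_0_iff)
    then show "y = b / (2 * a)" by simp
  next
    assume "y = b / (2 * a)"
    then show "\<forall>x. - a * x\<^sup>2 + b * x + c \<le> - a * y\<^sup>2 + b * y + c"
      unfolding sq using assms by simp
  qed
qed

section \<open>The joint law of capital and rate, and its conditional moments\<close>

context vasicek_log_capital
begin

text \<open>The model provides independence of the generated sigma-algebras; a measurable functional
  of the two paths generates a smaller sigma-algebra, so independence descends to it.\<close>

lemma R_initial_indep_path_functional:
  assumes L: "0 < L" and G: "G \<in> borel_measurable (path_space \<Otimes>\<^sub>M path_space)"
  shows "indep_var borel (R L 0) borel (\<lambda>\<omega>. G (path W1 \<omega>, path W2 \<omega>))"
proof -
  let ?P = "\<lambda>\<omega>. (path W1 \<omega>, path W2 \<omega>)" and ?PS = "path_space \<Otimes>\<^sub>M path_space"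
  let ?G = "\<lambda>\<omega>. G (path W1 \<omega>, path W2 \<omega>)"
  have P: "?P \<in> measurable M ?PS"
    using indep_var_rv1[OF indep_W1_W2] indep_var_rv2[OF indep_W1_W2] by measurable
  have "?P \<in> measurable (vimage_algebra (space M) ?P ?PS) ?PS"
    using measurable_space[OF P] by (intro measurable_vimage_algebra1) auto
  then have "?G \<in> borel_measurable (vimage_algebra (space M) ?P ?PS)"
    using G by (rule measurable_compose)
  then have sub: "sigma_sets (space M) {?G -` A \<inter> space M |A. A \<in> sets borel} \<subseteq> sets (vimage_algebra (space M) ?P ?PS)"
    using sets_image_in_sets[of "vimage_algebra (space M) ?P ?PS" "space M" ?G borel]
    by (simp add: sets_vimage_algebra)
  have "indep_set (sigma_sets (space M) {R L 0 -` A \<inter> space M |A. A \<in> sets borel})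
      (sigma_sets (space M) {?G -` A \<inter> space M |A. A \<in> sets borel})"
    using R_initial_indep[OF L] sub unfolding sets_vimage_algebra[of _ "R L 0"] indep_sets2_eq by blast
  moreover have "random_variable borel ?G" using P G by (rule measurable_compose)
  ultimately show ?thesis
    using R_measurable[OF L, of 0] by (simp add: indep_var_eq)
qed

text \<open>The capital depends on the rate only through the time integral of R, and the rate
  equation expresses that integral by R(t), R(0) and W2(t). No double integral of the noise
  arises.\<close>

lemma AE_explicit_solution:
  assumes L: "0 < L" and t: "0 < t" and \<beta>: "\<beta> \<noteq> 0"
  shows "AE \<omega> in M.
     R L t \<omega> = exp (\<beta> * t) * R L 0 \<omega> + B * (exp (\<beta> * t) - 1) / \<beta>
       + \<nu> * (W2 t \<omega> + \<beta> * integral {0..t} (\<lambda>s. exp (\<beta> * (t - s)) * W2 s \<omega>)) \<and>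
     F h L t \<omega> = f0 + (h * A1 - h\<^sup>2 * \<sigma>1\<^sup>2 / 2) * t
       + (h * \<alpha>1 + 1 - h) / \<beta> * (R L t \<omega> - R L 0 \<omega> - B * t - \<nu> * W2 t \<omega>) + h * \<sigma>1 * W1 t \<omega>"
proof -
  have "AE \<omega> in M. continuous_on {0..} (\<lambda>t. W2 t \<omega>)" using W2 by (simp add: brownian_motion_def)
  then show ?thesis
    using R_continuous[OF L] R_sde[OF L] F_sde[OF L, of h]
  proof eventually_elim
    case (elim \<omega>)
    have R: "continuous_on {0..t} (\<lambda>s. R L s \<omega>)" and W: "continuous_on {0..t} (\<lambda>s. W2 s \<omega>)"
      by (auto intro: continuous_on_subset[OF elim(1)] continuous_on_subset[OF elim(2)])
    have eq: "R L s \<omega> = R L 0 \<omega> + integral {0..s} (\<lambda>s. B + \<beta> * R L s \<omega>) + \<nu> * W2 s \<omega>" if "s \<in> {0..t}" for s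
      by (rule elim(3)[rule_format]) (use that in simp)
    note sol = linear_integral_equation[where x="\<lambda>s. R L s \<omega>" and w="\<lambda>s. W2 s \<omega>", OF less_imp_le[OF t] \<beta> R W eq]
    have I: "integral {0..t} (\<lambda>s. R L s \<omega>) = (R L t \<omega> - R L 0 \<omega> - B * t - \<nu> * W2 t \<omega>) / \<beta>"
      by (rule sol(2))
    have "integral {0..t} (\<lambda>s. h * A1 - h\<^sup>2 * \<sigma>1\<^sup>2 / 2 + (h * \<alpha>1 + 1 - h) * R L s \<omega>)
        = integral {0..t} (\<lambda>s. h * A1 - h\<^sup>2 * \<sigma>1\<^sup>2 / 2) + integral {0..t} (\<lambda>s. (h * \<alpha>1 + 1 - h) * R L s \<omega>)"
      by (intro Henstock_Kurzweil_Integration.integral_add integrable_continuous_interval continuous_intros R)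
    also have "\<dots> = (h * A1 - h\<^sup>2 * \<sigma>1\<^sup>2 / 2) * t
        + (h * \<alpha>1 + 1 - h) / \<beta> * (R L t \<omega> - R L 0 \<omega> - B * t - \<nu> * W2 t \<omega>)"
      using t by (simp add: I)
    finally have "integral {0..t} (\<lambda>s. h * A1 - h\<^sup>2 * \<sigma>1\<^sup>2 / 2 + (h * \<alpha>1 + 1 - h) * R L s \<omega>)
        = (h * A1 - h\<^sup>2 * \<sigma>1\<^sup>2 / 2) * t
        + (h * \<alpha>1 + 1 - h) / \<beta> * (R L t \<omega> - R L 0 \<omega> - B * t - \<nu> * W2 t \<omega>)" .
    note int = this
    show ?case
    proof (intro conjI)
      show "R L t \<omega> = exp (\<beta> * t) * R L 0 \<omega> + B * (exp (\<beta> * t) - 1) / \<beta>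
          + \<nu> * (W2 t \<omega> + \<beta> * integral {0..t} (\<lambda>s. exp (\<beta> * (t - s)) * W2 s \<omega>))"
        by (rule sol(1))
      show "F h L t \<omega> = f0 + (h * A1 - h\<^sup>2 * \<sigma>1\<^sup>2 / 2) * t
          + (h * \<alpha>1 + 1 - h) / \<beta> * (R L t \<omega> - R L 0 \<omega> - B * t - \<nu> * W2 t \<omega>) + h * \<sigma>1 * W1 t \<omega>"
        using elim(4)[rule_format, OF less_imp_le[OF t]] unfolding int by (simp only: add.assoc)
    qed
  qed
qed

text \<open>
  Given \<open>R L t = r\<close>, backward solution of the linear equation expresses \<open>F h L t\<close> as \<open>\<mu>0 + \<mu>1 * r\<close>
  plus a centred Gaussian \<open>Y\<close> of variance \<open>V\<close>, whose \<open>W2\<close>-integrand is \<open>g * e2\<close>.  The noise of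
  \<open>R L t\<close> has integrand \<open>\<nu> * e1\<close>; \<open>\<kappa>\<close> is the coefficient of its regression on \<open>Y\<close>.
\<close>

lemma law_log_capital_rate:
  fixes h t :: real
  defines "e1 \<equiv> \<lambda>s. exp (\<beta> * (t - s))" and "e2 \<equiv> \<lambda>s. exp (- \<beta> * s) - 1"
    and "g \<equiv> (h * \<alpha>1 + 1 - h) / \<beta>" and "K \<equiv> B * (exp (\<beta> * t) - 1) / \<beta>"
  defines "V \<equiv> (g * \<nu>)\<^sup>2 * integral {0..t} (\<lambda>s. (e2 s)\<^sup>2) + (h * \<sigma>1)\<^sup>2 * t"
  defines "\<kappa> \<equiv> g * \<nu> * integral {0..t} (\<lambda>s. e1 s * e2 s) / V"
  defines "Z \<equiv> integral {0..t} (\<lambda>s. (e1 s)\<^sup>2) - \<kappa>\<^sup>2 * V"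
    and "\<mu>0 \<equiv> f0 + (h * A1 - h\<^sup>2 * \<sigma>1\<^sup>2 / 2) * t + g * (exp (- \<beta> * t) * K - B * t)"
    and "\<mu>1 \<equiv> g * (1 - exp (- \<beta> * t))"
  assumes L: "0 < L" and t: "0 < t" and \<beta>: "\<beta> \<noteq> 0" and \<nu>: "0 < \<nu>" and V: "0 < V" and Z: "0 < Z"
  shows "distr M (borel \<Otimes>\<^sub>M borel) (\<lambda>\<omega>. (F h L t \<omega>, R L t \<omega>))
    = smoothed_uniform_law L \<mu>0 \<mu>1 (sqrt V) (\<nu> * sqrt Z) K (exp (\<beta> * t)) (\<nu> * \<kappa>)"
proof (rule pair_char_unique)
  note [measurable] = F_measurable[OF L less_imp_le[OF t], of h] R_measurable[OF L less_imp_le[OF t]]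
  let ?T = "smoothed_uniform_law L \<mu>0 \<mu>1 (sqrt V) (\<nu> * sqrt Z) K (exp (\<beta> * t)) (\<nu> * \<kappa>)"
  have pos: "0 < sqrt V" "0 < \<nu> * sqrt Z" using V Z \<nu> by auto
  show "finite_measure (distr M (borel \<Otimes>\<^sub>M borel) (\<lambda>\<omega>. (F h L t \<omega>, R L t \<omega>)))"
    by (intro finite_measure_distr) measurable
  show "finite_measure ?T"
  proof -
    interpret U: prob_space "uniform_measure lborel {-L..L}"
      using L by (intro prob_space_uniform_measure) auto
    interpret N1: prob_space "density lborel (normal_density 0 (sqrt V))"
      using pos(1) by (rule prob_space_normal_density)
    interpret N2: prob_space "density lborel (normal_density 0 (\<nu> * sqrt Z))"
      using pos(2) by (rule prob_space_normal_density)
    interpret NN: pair_prob_space "density lborel (normal_density 0 (sqrt V))"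
      "density lborel (normal_density 0 (\<nu> * sqrt Z))" ..
    interpret UNN: pair_prob_space "uniform_measure lborel {-L..L}"
      "density lborel (normal_density 0 (sqrt V)) \<Otimes>\<^sub>M density lborel (normal_density 0 (\<nu> * sqrt Z))" ..
    show ?thesis unfolding smoothed_uniform_law_def by (rule UNN.P.finite_measure_distr) measurable
  qed
  fix u v :: real
  define w where "w = u * \<mu>1 + v"
  \<comment> \<open>Because \<open>exp (- \<beta> * s) = exp (- \<beta> * t) * e1 s\<close>, the
    exponential part of \<open>e2\<close> is a multiple of \<open>e1\<close>. Here \<open>p\<close>
    is the resulting total coefficient of \<open>e1\<close> in the W2-integrand \<open>c\<close> of
    \<open>u * F + v * R\<close>, and \<open>- u * (g * \<nu>)\<close> is its constant part.\<close>
  define p where "p = w * \<nu> + u * (g * \<nu>) * exp (- \<beta> * t)"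
  define c where "c s = p * e1 s - u * (g * \<nu>)" for s
  define c' where "c' s = - \<beta> * p * e1 s" for s
  have qE: "exp (- \<beta> * t) * exp (\<beta> * t) = 1" by (simp add: exp_add[symmetric])
  have e1c: "continuous_on {0..t} e1" and e2c: "continuous_on {0..t} e2"
    unfolding e1_def e2_def by (intro continuous_intros)+
  have c_eq: "c s = (w * \<nu>) * e1 s + (u * (g * \<nu>)) * e2 s" for s
  proof -
    have "exp (- \<beta> * s) = exp (- \<beta> * t) * e1 s" by (simp add: e1_def exp_add[symmetric] algebra_simps)
    then show ?thesis unfolding c_def p_def e2_def by (simp add: algebra_simps)
  qed
  have S_eq: "AE \<omega> in M. u * F h L t \<omega> + v * R L t \<omega> = (u * \<mu>0 + w * K) + (w * exp (\<beta> * t)) * R L 0 \<omega>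
      + (c t * W2 t \<omega> - integral {0..t} (\<lambda>s. W2 s \<omega> * c' s)) + (u * (h * \<sigma>1)) * W1 t \<omega>"
    using AE_explicit_solution[OF L t \<beta>, of h]
  proof eventually_elim
    case (elim \<omega>)
    define J where "J = integral {0..t} (\<lambda>s. e1 s * W2 s \<omega>)"
    have "integral {0..t} (\<lambda>s. W2 s \<omega> * c' s) = integral {0..t} (\<lambda>s. (- \<beta> * p) * (e1 s * W2 s \<omega>))"
      by (intro Henstock_Kurzweil_Integration.integral_cong) (simp add: c'_def)
    then have Jc: "integral {0..t} (\<lambda>s. W2 s \<omega> * c' s) = - \<beta> * p * J" by (simp add: J_def)
    have R: "R L t \<omega> = exp (\<beta> * t) * R L 0 \<omega> + K + \<nu> * (W2 t \<omega> + \<beta> * J)"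
      using elim by (simp add: K_def J_def e1_def)
    have F: "F h L t \<omega> = f0 + (h * A1 - h\<^sup>2 * \<sigma>1\<^sup>2 / 2) * t
       + g * (R L t \<omega> - R L 0 \<omega> - B * t - \<nu> * W2 t \<omega>) + h * \<sigma>1 * W1 t \<omega>"
      using elim by (simp add: g_def)
    have ct: "c t = p - u * (g * \<nu>)" by (simp add: c_def e1_def)
    show ?case unfolding F Jc ct \<mu>0_def p_def w_def \<mu>1_def R using qE by algebra
  qed
  have "(CLINT \<omega>|M. iexp (u * F h L t \<omega> + v * R L t \<omega>)) =
      iexp (u * \<mu>0 + w * K) * (CLINT \<omega>|M. iexp (w * exp (\<beta> * t) * R L 0 \<omega>))
      * of_real (exp (- (integral {0..t} (\<lambda>s. (c s)\<^sup>2) + (u * (h * \<sigma>1))\<^sup>2 * t) / 2))"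
  proof (rule wiener_functional_char[where S="\<lambda>\<omega>. u * F h L t \<omega> + v * R L t \<omega>" and c=c and c'=c', OF W1 W2 indep_W1_W2 R_initial_indep_path_functional[OF L] t _ _ _ S_eq])
    show "(c has_real_derivative c' s) (at s within {0..t})" for s
      unfolding c_def[abs_def] c'_def e1_def by (auto intro!: derivative_eq_intros)
    show "continuous_on {0..t} c'" unfolding c'_def[abs_def] by (intro continuous_intros e1c)
  qed auto
  also have "(CLINT \<omega>|M. iexp (w * exp (\<beta> * t) * R L 0 \<omega>)) =
      (CLINT \<rho>|uniform_measure lborel {-L..L}. iexp (w * exp (\<beta> * t) * \<rho>))"
    unfolding R_initial[OF L, symmetric] using R_measurable[OF L, of 0] by (subst integral_distr) auto
  \<comment> \<open>Regression identity: the cross term equals \<open>\<kappa> * V\<close> by the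
    choice of \<kappa>, so the quadratic form in (w, u) is a square with weight \<open>V\<close>
    plus a remainder in \<open>w\<close> alone with weight \<open>\<nu>\<^sup>2 * Z\<close>.\<close>
  also have "integral {0..t} (\<lambda>s. (c s)\<^sup>2) + (u * (h * \<sigma>1))\<^sup>2 * t
      = (w * (\<nu> * \<kappa>) + u)\<^sup>2 * (sqrt V)\<^sup>2 + w\<^sup>2 * (\<nu> * sqrt Z)\<^sup>2"
  proof -
    have "integral {0..t} (\<lambda>s. (c s)\<^sup>2) = (w * \<nu>)\<^sup>2 * integral {0..t} (\<lambda>s. (e1 s)\<^sup>2)
        + 2 * (w * \<nu>) * (u * (g * \<nu>)) * integral {0..t} (\<lambda>s. e1 s * e2 s)
        + (u * (g * \<nu>))\<^sup>2 * integral {0..t} (\<lambda>s. (e2 s)\<^sup>2)"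
      unfolding c_eq by (rule integral_square_linear_combination[OF e1c e2c])
    moreover have "g * \<nu> * integral {0..t} (\<lambda>s. e1 s * e2 s) = \<kappa> * V" using V by (simp add: \<kappa>_def)
    moreover have "integral {0..t} (\<lambda>s. (e1 s)\<^sup>2) = Z + \<kappa>\<^sup>2 * V" by (simp add: Z_def)
    moreover have "(sqrt V)\<^sup>2 = V" "(sqrt Z)\<^sup>2 = Z" using V Z by auto
    ultimately show ?thesis using V_def unfolding power_mult_distrib by algebra
  qed
  finally show "(CLINT z|distr M (borel \<Otimes>\<^sub>M borel) (\<lambda>\<omega>. (F h L t \<omega>, R L t \<omega>)). iexp (u * fst z + v * snd z))
      = (CLINT z|?T. iexp (u * fst z + v * snd z))"
    unfolding smoothed_uniform_law_char[OF pos L] w_def[symmetric]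
    by (subst integral_distr) (auto simp: mult.assoc)
qed (simp_all add: smoothed_uniform_law_def)

text \<open>Numerator and denominator are rescaled by the same \<open>2 * L\<close>, and both limits
  carry the same factor \<open>1 / exp (\<beta> * t)\<close>. Their quotient tends to a moment of
  the normal law with mean \<open>m\<close> and variance \<open>V\<close>.\<close>

lemma truncated_cond_moment_tendsto:
  fixes h t r :: real
  defines "e2 \<equiv> \<lambda>s. exp (- \<beta> * s) - 1"
    and "g \<equiv> (h * \<alpha>1 + 1 - h) / \<beta>" and "K \<equiv> B * (exp (\<beta> * t) - 1) / \<beta>"
  defines "V \<equiv> (g * \<nu>)\<^sup>2 * integral {0..t} (\<lambda>s. (e2 s)\<^sup>2) + (h * \<sigma>1)\<^sup>2 * t"
    and "m \<equiv> f0 + (h * A1 - h\<^sup>2 * \<sigma>1\<^sup>2 / 2) * t + g * (exp (- \<beta> * t) * K - B * t)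
      + g * (1 - exp (- \<beta> * t)) * r"
  assumes t: "0 < t" and \<beta>: "\<beta> \<noteq> 0" and \<nu>: "0 < \<nu>" and \<sigma>1: "0 < \<sigma>1"
  shows "(truncated_cond_moment 1 M R F t r h \<longlongrightarrow> m) at_top"
    and "(truncated_cond_moment 2 M R F t r h \<longlongrightarrow> V + m\<^sup>2) at_top"
proof -
  define e1 where "e1 s = exp (\<beta> * (t - s))" for s
  define \<kappa> where "\<kappa> = g * \<nu> * integral {0..t} (\<lambda>s. e1 s * e2 s) / V"
  define Z where "Z = integral {0..t} (\<lambda>s. (e1 s)\<^sup>2) - \<kappa>\<^sup>2 * V"
  define \<mu>0 where "\<mu>0 = f0 + (h * A1 - h\<^sup>2 * \<sigma>1\<^sup>2 / 2) * t + g * (exp (- \<beta> * t) * K - B * t)"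
  define \<mu>1 where "\<mu>1 = g * (1 - exp (- \<beta> * t))"
  have e1c: "continuous_on {0..t} e1" and e2c: "continuous_on {0..t} e2"
    unfolding e1_def[abs_def] e2_def by (intro continuous_intros)+
  have E22: "0 < integral {0..t} (\<lambda>s. (e2 s)\<^sup>2)"
    using t \<beta> by (intro integral_square_pos[OF t e2c, of t]) (auto simp: e2_def)
  \<comment> \<open>The two noises cover for each other: if \<open>h = 0\<close> the W1 part
    vanishes but \<open>g = 1 / \<beta>\<close> is nonzero, and if \<open>h\<close> is nonzero the
    W1 part is already positive.\<close>
  have V: "0 < V"
  proof (cases "h = 0")
    case True
    then show ?thesis using E22 \<beta> \<nu> by (simp add: V_def g_def)
  next
    case False
    then have "0 < (h * \<sigma>1)\<^sup>2 * t" using \<sigma>1 t by simp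
    then show ?thesis using E22 unfolding V_def by (intro add_nonneg_pos) auto
  qed
  \<comment> \<open>\<open>Z\<close> is the squared norm of
    \<open>e1 - \<kappa> * (g * \<nu>) * e2\<close> plus a nonnegative W1 contribution. The norm is
    positive because at time 0 the function \<open>e2\<close> vanishes while \<open>e1\<close> does
    not.\<close>
  have Z: "0 < Z"
  proof -
    have "0 < integral {0..t} (\<lambda>s. (1 * e1 s + (- (\<kappa> * (g * \<nu>))) * e2 s)\<^sup>2)"
      using t by (intro integral_square_pos[where x=0] continuous_intros e1c e2c)
        (auto simp: e1_def e2_def)
    also have "\<dots> = integral {0..t} (\<lambda>s. (e1 s)\<^sup>2) - 2 * \<kappa> * (g * \<nu> * integral {0..t} (\<lambda>s. e1 s * e2 s))
        + \<kappa>\<^sup>2 * ((g * \<nu>)\<^sup>2 * integral {0..t} (\<lambda>s. (e2 s)\<^sup>2))"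
      unfolding integral_square_linear_combination[OF e1c e2c] by (simp add: power_mult_distrib)
    also have "g * \<nu> * integral {0..t} (\<lambda>s. e1 s * e2 s) = \<kappa> * V" using V by (simp add: \<kappa>_def)
    also have "(g * \<nu>)\<^sup>2 * integral {0..t} (\<lambda>s. (e2 s)\<^sup>2) = V - (h * \<sigma>1)\<^sup>2 * t" by (simp add: V_def)
    also have "integral {0..t} (\<lambda>s. (e1 s)\<^sup>2) - 2 * \<kappa> * (\<kappa> * V) + \<kappa>\<^sup>2 * (V - (h * \<sigma>1)\<^sup>2 * t)
        = Z - \<kappa>\<^sup>2 * ((h * \<sigma>1)\<^sup>2 * t)"
      by (simp add: Z_def power2_eq_square algebra_simps)
    also have "\<dots> \<le> Z" using t by simp
    finally show ?thesis .
  qed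
  have pos: "0 < sqrt V" "0 < \<nu> * sqrt Z" "0 < exp (\<beta> * t)" using V Z \<nu> by auto
  let ?p = "\<lambda>L. smoothed_uniform_density L \<mu>0 \<mu>1 (sqrt V) (\<nu> * sqrt Z) K (exp (\<beta> * t)) (\<nu> * \<kappa>)"
  have dens: "joint_density M (F h L t) (R L t) = ?p L" if L: "0 < L" for L
  proof (rule joint_density_eqI)
    show "continuous_on UNIV (\<lambda>(f, r). ?p L f r)" by (intro continuous_smoothed_uniform_density pos L)
    then have "(\<lambda>(f, r). ?p L f r) \<in> borel_measurable borel" by (rule borel_measurable_continuous_onI)
    then have meas: "(\<lambda>(f, r). ennreal (?p L f r)) \<in> borel_measurable (lborel \<Otimes>\<^sub>M lborel)"
      unfolding lborel_prod by (simp add: case_prod_unfold)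
    show "0 \<le> ?p L f r" for f r by (rule smoothed_uniform_density_nonneg[OF L])
    note [measurable] = F_measurable[OF L less_imp_le[OF t], of h] R_measurable[OF L less_imp_le[OF t]]
    have "distr M (borel \<Otimes>\<^sub>M borel) (\<lambda>\<omega>. (F h L t \<omega>, R L t \<omega>))
      = smoothed_uniform_law L \<mu>0 \<mu>1 (sqrt V) (\<nu> * sqrt Z) K (exp (\<beta> * t)) (\<nu> * \<kappa>)"
      using law_log_capital_rate[OF L t \<beta> \<nu>, of h] V Z
      by (simp add: \<mu>0_def \<mu>1_def V_def Z_def K_def \<kappa>_def g_def e1_def e2_def)
    also have "\<dots> = density (lborel \<Otimes>\<^sub>M lborel) (\<lambda>(f, r). ennreal (?p L f r))"
      by (rule smoothed_uniform_law_eq_density[OF pos(1,2) L])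
    finally have "distr M (lborel \<Otimes>\<^sub>M lborel) (\<lambda>\<omega>. (F h L t \<omega>, R L t \<omega>))
        = density (lborel \<Otimes>\<^sub>M lborel) (\<lambda>(f, r). ennreal (?p L f r))"
      by (simp cong: distr_cong sets_pair_measure_cong)
    then show "distributed M (lborel \<Otimes>\<^sub>M lborel) (\<lambda>\<omega>. (F h L t \<omega>, R L t \<omega>)) (\<lambda>(f, r). ennreal (?p L f r))"
      using meas by (simp add: distributed_def)
  qed
  have m: "m = \<mu>0 + \<mu>1 * r" by (simp add: m_def \<mu>0_def \<mu>1_def)
  let ?N = "\<lambda>k L. 2 * L * (LINT f:{-L..L}|lborel. f ^ k * ?p L f r)"
  have lim: "(?N k \<longlongrightarrow> x / exp (\<beta> * t)) at_top"
    if "has_bochner_integral lborel (\<lambda>f. f ^ k * normal_density 0 (sqrt V) (f - m)) x" for k x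
    using that by (intro truncated_moment_tendsto pos) (simp add: m diff_diff_eq)
  have ratio: "(truncated_cond_moment k M R F t r h \<longlongrightarrow> x) at_top"
    if k: "has_bochner_integral lborel (\<lambda>f. f ^ k * normal_density 0 (sqrt V) (f - m)) x" for k x
  proof -
    \<comment> \<open>The normalising integral in the denominator is the moment of order 0, so one
      limit lemma serves both parts of the quotient.\<close>
    have "((\<lambda>L. ?N k L / ?N 0 L) \<longlongrightarrow> (x / exp (\<beta> * t)) / (1 / exp (\<beta> * t))) at_top"
      by (intro tendsto_divide lim k normal_raw_moments(1) pos) simp
    moreover have "\<forall>\<^sub>F L in at_top. ?N k L / ?N 0 L = truncated_cond_moment k M R F t r h L"
      using eventually_gt_at_top[of 0]
      by eventually_elim (simp add: truncated_cond_moment_def dens Let_def)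
    ultimately show ?thesis using Lim_transform_eventually by fastforce
  qed
  show "(truncated_cond_moment 1 M R F t r h \<longlongrightarrow> m) at_top"
    by (rule ratio[OF normal_raw_moments(2)[OF pos(1)]])
  show "(truncated_cond_moment 2 M R F t r h \<longlongrightarrow> V + m\<^sup>2) at_top"
    using ratio[OF normal_raw_moments(3)[OF pos(1), of m]] V by simp
qed

end

text \<open>\<open>Lim\<close> denotes some value even without convergence, so the existence of both
  limits is asserted alongside the formulas. The maximiser is characterised by an equivalence, which
  contains existence as well as uniqueness.\<close>

theorem mainTheorem1:
  fixes M :: "'a measure"
    and W1 W2 :: "real \<Rightarrow> 'a \<Rightarrow> real"
    and A1 \<alpha>1 \<sigma>1 B \<beta> \<nu> f0 \<gamma> t r :: real
    and R :: "real \<Rightarrow> real \<Rightarrow> 'a \<Rightarrow> real"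
    and F :: "real \<Rightarrow> real \<Rightarrow> real \<Rightarrow> 'a \<Rightarrow> real"
  assumes "vasicek_log_capital M W1 W2 A1 \<alpha>1 \<sigma>1 B \<beta> \<nu> f0 R F"
    and "\<sigma>1 > 0" and "\<nu> > 0" and "B > 0" and "\<beta> < 0" and "\<gamma> \<ge> 0" and "t > 0"
  shows
   "let \<phi> = exp (- 2 * \<beta> * t) - 4 * exp (- \<beta> * t) - 2 * \<beta> * t + 3;
        M2 = - (\<sigma>1\<^sup>2 * t / 2);
        M1 = (\<alpha>1 - 1) * (\<beta> * r + B) * (1 - exp (- \<beta> * t)) / \<beta>\<^sup>2
               - (B * (\<alpha>1 - 1) - \<beta> * A1) * t / \<beta>;
        M0 = (\<beta> * r + B) * (1 - exp (- \<beta> * t)) / \<beta>\<^sup>2 - B * t / \<beta> + f0;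
        L2 = - (\<nu>\<^sup>2 / (2 * \<beta> ^ 3)) * (\<alpha>1 - 1)\<^sup>2 * \<phi> + \<sigma>1\<^sup>2 * t;
        L1 = - (\<nu>\<^sup>2 / \<beta> ^ 3) * (\<alpha>1 - 1) * \<phi>;
        L0 = - (\<nu>\<^sup>2 / (2 * \<beta> ^ 3)) * \<phi>
    in (\<forall>h. (\<exists>l. (truncated_cond_moment 1 M R F t r h \<longlongrightarrow> l) at_top) \<and>
            (\<exists>l. (truncated_cond_moment 2 M R F t r h \<longlongrightarrow> l) at_top) \<and>
            cond_mean M R F t r h = M2 * h\<^sup>2 + M1 * h + M0 \<and>
            cond_variance M R F t r h = L2 * h\<^sup>2 + L1 * h + L0) \<and>
       (\<forall>H. (\<forall>h. Q_functional M R F \<gamma> t r h \<le> Q_functional M R F \<gamma> t r H)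
              \<longleftrightarrow> H = (M1 - \<gamma> * L1) / (\<sigma>1\<^sup>2 * t + 2 * \<gamma> * L2))"
proof -
  interpret vasicek_log_capital M W1 W2 A1 \<alpha>1 \<sigma>1 B \<beta> \<nu> f0 R F by fact
  have \<beta>: "\<beta> \<noteq> 0" using \<open>\<beta> < 0\<close> by simp
  define \<phi> where "\<phi> = exp (- 2 * \<beta> * t) - 4 * exp (- \<beta> * t) - 2 * \<beta> * t + 3"
  define M2 where "M2 = - (\<sigma>1\<^sup>2 * t / 2)"
  define M1 where "M1 = (\<alpha>1 - 1) * (\<beta> * r + B) * (1 - exp (- \<beta> * t)) / \<beta>\<^sup>2
    - (B * (\<alpha>1 - 1) - \<beta> * A1) * t / \<beta>"
  define M0 where "M0 = (\<beta> * r + B) * (1 - exp (- \<beta> * t)) / \<beta>\<^sup>2 - B * t / \<beta> + f0"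
  define L2 where "L2 = - (\<nu>\<^sup>2 / (2 * \<beta> ^ 3)) * (\<alpha>1 - 1)\<^sup>2 * \<phi> + \<sigma>1\<^sup>2 * t"
  define L1 where "L1 = - (\<nu>\<^sup>2 / \<beta> ^ 3) * (\<alpha>1 - 1) * \<phi>"
  define L0 where "L0 = - (\<nu>\<^sup>2 / (2 * \<beta> ^ 3)) * \<phi>"
  have E22: "integral {0..t} (\<lambda>s. (exp (- \<beta> * s) - 1)\<^sup>2) = - \<phi> / (2 * \<beta>)"
    unfolding \<phi>_def using \<beta> \<open>t > 0\<close> by (intro integral_exp_minus_one_square) auto
  have mean_eq: "f0 + (h * A1 - h\<^sup>2 * \<sigma>1\<^sup>2 / 2) * t
      + (h * \<alpha>1 + 1 - h) / \<beta> * (exp (- \<beta> * t) * (B * (exp (\<beta> * t) - 1) / \<beta>) - B * t)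
      + (h * \<alpha>1 + 1 - h) / \<beta> * (1 - exp (- \<beta> * t)) * r = M2 * h\<^sup>2 + M1 * h + M0" for h
  proof -
    have K: "exp (- \<beta> * t) * (B * (exp (\<beta> * t) - 1) / \<beta>) = B * (1 - exp (- \<beta> * t)) / \<beta>"
      by (simp add: exp_minus field_simps)
    show ?thesis
      unfolding K M2_def M1_def M0_def
      using \<beta> by (simp add: field_simps power2_eq_square)
  qed
  have var_eq: "((h * \<alpha>1 + 1 - h) / \<beta> * \<nu>)\<^sup>2 * integral {0..t} (\<lambda>s. (exp (- \<beta> * s) - 1)\<^sup>2)
      + (h * \<sigma>1)\<^sup>2 * t = L2 * h\<^sup>2 + L1 * h + L0" for h
    unfolding E22 L2_def L1_def L0_def using \<beta>
    by (simp add: field_simps power2_eq_square power3_eq_cube)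
  have lim1: "(truncated_cond_moment 1 M R F t r h \<longlongrightarrow> M2 * h\<^sup>2 + M1 * h + M0) at_top" for h
    using truncated_cond_moment_tendsto(1)[OF \<open>t > 0\<close> \<beta> \<open>\<nu> > 0\<close> \<open>\<sigma>1 > 0\<close>, where r=r and h=h]
    unfolding mean_eq .
  have lim2: "(truncated_cond_moment 2 M R F t r h \<longlongrightarrow>
      L2 * h\<^sup>2 + L1 * h + L0 + (M2 * h\<^sup>2 + M1 * h + M0)\<^sup>2) at_top" for h
    using truncated_cond_moment_tendsto(2)[OF \<open>t > 0\<close> \<beta> \<open>\<nu> > 0\<close> \<open>\<sigma>1 > 0\<close>, where r=r and h=h]
    unfolding mean_eq var_eq .
  have mean: "cond_mean M R F t r h = M2 * h\<^sup>2 + M1 * h + M0" for h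
    unfolding cond_mean_def by (rule tendsto_Lim[OF _ lim1]) simp
  have var: "cond_variance M R F t r h = L2 * h\<^sup>2 + L1 * h + L0" for h
    unfolding cond_variance_def mean tendsto_Lim[OF trivial_limit_at_top_linorder lim2] by simp
  \<comment> \<open>The sign comes from recognising the expression as the integral of a square. It
    makes \<open>L2 - \<sigma>1\<^sup>2 * t\<close>, which is this quantity times a square,
    nonnegative; together with \<open>\<gamma> \<ge> 0\<close> the quadratic coefficient of
    \<open>Q_functional\<close> is then strictly negative.\<close>
  have "0 \<le> - \<phi> / (2 * \<beta>)"
    unfolding E22[symmetric]
    by (intro Henstock_Kurzweil_Integration.integral_nonneg integrable_continuous_interval continuous_intros) auto
  then have "0 \<le> (\<nu> * (\<alpha>1 - 1) / \<beta>)\<^sup>2 * (- \<phi> / (2 * \<beta>))" by (rule mult_nonneg_nonneg[rotated]) simp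
  also have "\<dots> = L2 - \<sigma>1\<^sup>2 * t"
    unfolding L2_def using \<beta> by (simp add: field_simps power2_eq_square power3_eq_cube)
  finally have "0 \<le> L2" using zero_le_power2[of \<sigma>1] \<open>t > 0\<close> by (smt (verit) mult_nonneg_nonneg)
  then have pos: "0 < \<sigma>1\<^sup>2 * t / 2 + \<gamma> * L2"
    using \<open>\<sigma>1 > 0\<close> \<open>t > 0\<close> \<open>\<gamma> \<ge> 0\<close> by (intro add_pos_nonneg) auto
  \<comment> \<open>The mean contributes \<open>- \<sigma>1\<^sup>2 * t / 2\<close> to the leading
    coefficient; doubling that coefficient in the vertex formula gives the denominator
    \<open>\<sigma>1\<^sup>2 * t + 2 * \<gamma> * L2\<close>.\<close>
  have Q: "Q_functional M R F \<gamma> t r h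
      = - (\<sigma>1\<^sup>2 * t / 2 + \<gamma> * L2) * h\<^sup>2 + (M1 - \<gamma> * L1) * h + (M0 - \<gamma> * L0)" for h
    unfolding Q_functional_def mean var M2_def by (simp add: algebra_simps)
  have max: "(\<forall>h. Q_functional M R F \<gamma> t r h \<le> Q_functional M R F \<gamma> t r H)
      \<longleftrightarrow> H = (M1 - \<gamma> * L1) / (\<sigma>1\<^sup>2 * t + 2 * \<gamma> * L2)" for H
    unfolding Q concave_quadratic_unique_max[OF pos] by (simp add: algebra_simps)
  show ?thesis
    unfolding Let_def \<phi>_def[symmetric] M2_def[symmetric] M1_def[symmetric] M0_def[symmetric]
      L2_def[symmetric] L1_def[symmetric] L0_def[symmetric]
    using lim1 lim2 mean var max by blast
qed

end
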